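(* Let $B_+$ be the Bergman shift, i.e. the unilateral weighted shift with weights $\omega_n=\sqrt{\frac{n+1}{n+2}}$ ($n\ge0$), and let $\mathcal{SIE}(B_+)$ be its spherically isometric embedding. Then the Berger measure of $\mathcal{SIE}(B_+)$ is normalized arclength on the line segment $L:=\{(r,1-r):0\le r\le1\}$, and $\mathcal{SIE}(B_+)$ is unitarily equivalent to the commuting pair $(M_{z_1},M_{z_2})$ of multiplication operators by the coordinate functions on the Hardy space of the unit sphere $\mathbb{S}_3=\{(z_1,z_2)\in\mathbb{C}^2:|z_1|^2+|z_2|^2=1\}$.
   Context: $\mathbb{Z}_+=\{0,1,2,\dots\}$. A $2$-variable weighted shift $W_{(\alpha,\beta)}\equiv(T_1,T_2)$, with bounded positive weights $\alpha_{\mathbf k},\beta_{\mathbf k}$ ($\mathbf k\in\mathbb{Z}_+^2$), acts on $\ell^2(\mathbb{Z}_+^2)$ by $T_1e_{\mathbf k}=\alpha_{\mathbf k}e_{\mathbf k+(1,0)}$, $T_2e_{\mathbf k}=\beta_{\mathbf k}e_{\mathbf k+(0,1)}$, and is assumed commuting. Its moment $\gamma_{(k_1,k_2)}$ is the product of the squares of the weights along any nondecreasing lattice path from $(0,0)$ to $(k_1,k_2)$. It is (jointly) subnormal iff there is a probability measure $\mu$ on $[0,\|T_1\|^2]\times[0,\|T_2\|^2]$ (its Berger measure) with $\gamma_{(k_1,k_2)}=\int s^{k_1}t^{k_2}d\mu(s,t)$ for all $k_1,k_2\ge0$. The Berger measure of $B_+$ (the probability measure $\sigma$ with $\omega_0^2\cdots\omega_{k-1}^2=\int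 r^kd\sigma(r)$ for all $k$) is Lebesgue measure on $[0,1]$. Its spherically isometric embedding $\mathcal{SIE}(B_+)$ is the $2$-variable weighted shift with moments $\gamma_{(k_1,k_2)}=\int_0^1r^{k_1}(1-r)^{k_2}dr$; equivalently, its weights are $$\alpha_{(k_1,k_2)}=\sqrt{\frac{k_1+1}{k_1+k_2+2}},\qquad \beta_{(k_1,k_2)}=\sqrt{\frac{k_2+1}{k_1+k_2+2}},$$ so that $\alpha_{\mathbf k}^2+\beta_{\mathbf k}^2=1$ for all $\mathbf k$. Normalized arclength means arclength measure scaled to total mass $1$. The Hardy space of $\mathbb{S}_3$ is the closure of the holomorphic polynomials in $z_1,z_2$ in $L^2$ of the normalized surface measure on $\mathbb{S}_3$. Unitary equivalence of pairs means that a single unitary intertwines both components. *)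

theory Defs
  imports "HOL-Probability.Probability"
begin

section \<open>Hausdorff measure: arclength and surface area\<close>

text \<open>
  With the factor below, the \<open>d\<close>-dimensional Hausdorff measure of a \<open>d\<close>-dimensional \<open>C\<^sup>1\<close> submanifold
  of a Euclidean space is its \<open>d\<close>-dimensional surface area (arclength if \<open>d = 1\<close>).
  The library's \<^const>\<open>diameter\<close> is meaningful on bounded sets only, hence the boundedness
  condition on the covers.
\<close>

definition diam_content :: "nat \<Rightarrow> 'a::metric_space set \<Rightarrow> ennreal" where
  "diam_content d S = (if S = {} then 0 else ennreal (unit_ball_vol (real d) * (diameter S / 2) ^ d))"

definition hausdorff_pre :: "nat \<Rightarrow> real \<Rightarrow> 'a::metric_space set \<Rightarrow> ennreal" where
  "hausdorff_pre d \<delta> A =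
     (INF C \<in> {C :: nat \<Rightarrow> 'a set. A \<subseteq> (\<Union>i. C i) \<and> (\<forall>i. bounded (C i) \<and> diameter (C i) \<le> \<delta>)}.
        \<Sum>i. diam_content d (C i))"

definition hausdorff_outer :: "nat \<Rightarrow> 'a::metric_space set \<Rightarrow> ennreal" where
  "hausdorff_outer d A = (SUP \<delta> \<in> {0<..}. hausdorff_pre d \<delta> A)"

definition hausdorff_measure :: "nat \<Rightarrow> 'a::metric_space measure" where
  "hausdorff_measure d = measure_of UNIV (sets borel) (hausdorff_outer d)"

text \<open>
  The library's \<^const>\<open>uniform_measure\<close> restricts a measure to a set and scales it to total mass 1.
  The products \<open>real \<times> real\<close> and \<open>complex \<times> complex\<close> carry the Euclidean metric.
\<close>

definition segment_L :: "(real \<times> real) set" where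
  "segment_L = {(r, 1 - r) | r. 0 \<le> r \<and> r \<le> 1}"

definition normalized_arclength_L :: "(real \<times> real) measure" where
  "normalized_arclength_L = uniform_measure (hausdorff_measure 1) segment_L"

definition sphere_S3 :: "(complex \<times> complex) set" where
  "sphere_S3 = {(z1, z2). (cmod z1)\<^sup>2 + (cmod z2)\<^sup>2 = 1}"

definition normalized_surface_S3 :: "(complex \<times> complex) measure" where
  "normalized_surface_S3 = uniform_measure (hausdorff_measure 3) sphere_S3"


section \<open>Complex \<open>L\<^sup>2\<close> spaces and unitary equivalence of pairs\<close>

text \<open>
  Elements of \<open>L\<^sup>2(M)\<close> are represented by square-integrable functions; two functions represent the
  same element iff they agree almost everywhere.
\<close>

definition Lsq :: "'a measure \<Rightarrow> ('a \<Rightarrow> complex) set" where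
  "Lsq M = {f \<in> borel_measurable M. integrable M (\<lambda>x. (cmod (f x))\<^sup>2)}"

definition Lsq_inner :: "'a measure \<Rightarrow> ('a \<Rightarrow> complex) \<Rightarrow> ('a \<Rightarrow> complex) \<Rightarrow> complex" where
  "Lsq_inner M f g = (\<integral>x. f x * cnj (g x) \<partial>M)"

definition Lsq_norm :: "'a measure \<Rightarrow> ('a \<Rightarrow> complex) \<Rightarrow> real" where
  "Lsq_norm M f = sqrt (\<integral>x. (cmod (f x))\<^sup>2 \<partial>M)"

definition Lsq_opnorm :: "'a measure \<Rightarrow> (('a \<Rightarrow> complex) \<Rightarrow> ('a \<Rightarrow> complex)) \<Rightarrow> real" where
  "Lsq_opnorm M T = Sup {Lsq_norm M (T f) | f. f \<in> Lsq M \<and> Lsq_norm M f \<le> 1}"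

text \<open>\<open>U\<close> is a unitary from the subspace \<open>H\<close> of \<open>L\<^sup>2(M)\<close> onto the subspace \<open>K\<close> of \<open>L\<^sup>2(N)\<close>.\<close>

definition unitary_between ::
  "'a measure \<Rightarrow> ('a \<Rightarrow> complex) set \<Rightarrow> 'b measure \<Rightarrow> ('b \<Rightarrow> complex) set
     \<Rightarrow> (('a \<Rightarrow> complex) \<Rightarrow> ('b \<Rightarrow> complex)) \<Rightarrow> bool" where
  "unitary_between M H N K U \<longleftrightarrow>
     U \<in> H \<rightarrow> K \<and>
     (\<forall>f\<in>H. \<forall>g\<in>H. \<forall>a b. AE y in N. U (\<lambda>x. a * f x + b * g x) y = a * U f y + b * U g y) \<and>
     (\<forall>f\<in>H. \<forall>g\<in>H. Lsq_inner N (U f) (U g) = Lsq_inner M f g) \<and>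
     (\<forall>g\<in>K. \<exists>f\<in>H. AE y in N. U f y = g y)"

definition unitarily_equivalent_pairs ::
  "'a measure \<Rightarrow> ('a \<Rightarrow> complex) set
     \<Rightarrow> (('a \<Rightarrow> complex) \<Rightarrow> ('a \<Rightarrow> complex)) \<times> (('a \<Rightarrow> complex) \<Rightarrow> ('a \<Rightarrow> complex))
     \<Rightarrow> 'b measure \<Rightarrow> ('b \<Rightarrow> complex) set
     \<Rightarrow> (('b \<Rightarrow> complex) \<Rightarrow> ('b \<Rightarrow> complex)) \<times> (('b \<Rightarrow> complex) \<Rightarrow> ('b \<Rightarrow> complex))
     \<Rightarrow> bool" where
  "unitarily_equivalent_pairs M H T N K S \<longleftrightarrow>
     fst T \<in> H \<rightarrow> H \<and> snd T \<in> H \<rightarrow> H \<and> fst S \<in> K \<rightarrow> K \<and> snd S \<in> K \<rightarrow> K \<and>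
     (\<exists>U. unitary_between M H N K U \<and>
        (\<forall>f\<in>H. AE y in N. U (fst T f) y = fst S (U f) y) \<and>
        (\<forall>f\<in>H. AE y in N. U (snd T f) y = snd S (U f) y))"


section \<open>The Hardy space of the sphere\<close>

definition holomorphic_polynomials :: "(complex \<times> complex \<Rightarrow> complex) set" where
  "holomorphic_polynomials =
     {p. \<exists>n c. \<forall>z1 z2. p (z1, z2) = (\<Sum>i\<le>n. \<Sum>j\<le>n. c i j * z1 ^ i * z2 ^ (j::nat))}"

definition hardy_S3 :: "(complex \<times> complex \<Rightarrow> complex) set" where
  "hardy_S3 = {f \<in> Lsq normalized_surface_S3.
     \<forall>\<epsilon>>0. \<exists>p\<in>holomorphic_polynomials. Lsq_norm normalized_surface_S3 (\<lambda>z. f z - p z) < \<epsilon>}"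

definition mult_op :: "('a \<Rightarrow> complex) \<Rightarrow> ('a \<Rightarrow> complex) \<Rightarrow> ('a \<Rightarrow> complex)" where
  "mult_op \<phi> f = (\<lambda>x. \<phi> x * f x)"


section \<open>Weighted shifts and Berger measures\<close>

abbreviation grid :: "(nat \<times> nat) measure" where
  "grid \<equiv> count_space UNIV"

text \<open>
  The bounded operators on \<open>\<ell>\<^sup>2(\<int>\<^sub>+\<^sup>2) = L\<^sup>2(grid)\<close> given on the orthonormal basis by
  \<open>T\<^sub>1 e\<^sub>k = \<alpha>\<^sub>k e\<^sub>k\<^sub>+\<^sub>(\<^sub>1\<^sub>,\<^sub>0\<^sub>)\<close> and \<open>T\<^sub>2 e\<^sub>k = \<beta>\<^sub>k e\<^sub>k\<^sub>+\<^sub>(\<^sub>0\<^sub>,\<^sub>1\<^sub>)\<close> (see the two lemmas below),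
  written out on coordinates.
\<close>

definition shift1 :: "(nat \<Rightarrow> nat \<Rightarrow> real) \<Rightarrow> (nat \<times> nat \<Rightarrow> complex) \<Rightarrow> (nat \<times> nat \<Rightarrow> complex)" where
  "shift1 \<alpha> f = (\<lambda>(k1, k2). case k1 of 0 \<Rightarrow> 0 | Suc j \<Rightarrow> complex_of_real (\<alpha> j k2) * f (j, k2))"

definition shift2 :: "(nat \<Rightarrow> nat \<Rightarrow> real) \<Rightarrow> (nat \<times> nat \<Rightarrow> complex) \<Rightarrow> (nat \<times> nat \<Rightarrow> complex)" where
  "shift2 \<beta> f = (\<lambda>(k1, k2). case k2 of 0 \<Rightarrow> 0 | Suc j \<Rightarrow> complex_of_real (\<beta> k1 j) * f (k1, j))"

lemma shift1_basis:
  "shift1 \<alpha> (indicator {(k1, k2)}) = (\<lambda>x. complex_of_real (\<alpha> k1 k2) * indicator {(k1 + 1, k2)} x)"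
  by (auto simp: shift1_def fun_eq_iff indicator_def split: nat.splits)

lemma shift2_basis:
  "shift2 \<beta> (indicator {(k1, k2)}) = (\<lambda>x. complex_of_real (\<beta> k1 k2) * indicator {(k1, k2 + 1)} x)"
  by (auto simp: shift2_def fun_eq_iff indicator_def split: nat.splits)

text \<open>
  The moment along the path that first goes right and then up; for commuting shifts, i.e.
  \<open>\<beta>\<^sub>k\<^sub>+\<^sub>(\<^sub>1\<^sub>,\<^sub>0\<^sub>) \<alpha>\<^sub>k = \<alpha>\<^sub>k\<^sub>+\<^sub>(\<^sub>0\<^sub>,\<^sub>1\<^sub>) \<beta>\<^sub>k\<close>, any other nondecreasing path gives the same value.
\<close>

definition shift_moment :: "(nat \<Rightarrow> nat \<Rightarrow> real) \<Rightarrow> (nat \<Rightarrow> nat \<Rightarrow> real) \<Rightarrow> nat \<Rightarrow> nat \<Rightarrow> real" where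
  "shift_moment \<alpha> \<beta> k1 k2 = (\<Prod>i<k1. (\<alpha> i 0)\<^sup>2) * (\<Prod>j<k2. (\<beta> k1 j)\<^sup>2)"

definition is_berger_measure2 ::
  "(nat \<Rightarrow> nat \<Rightarrow> real) \<Rightarrow> (nat \<Rightarrow> nat \<Rightarrow> real) \<Rightarrow> (real \<times> real) measure \<Rightarrow> bool" where
  "is_berger_measure2 \<alpha> \<beta> \<mu> \<longleftrightarrow>
     prob_space \<mu> \<and> sets \<mu> = sets borel \<and>
     (AE x in \<mu>. x \<in> {0..(Lsq_opnorm grid (shift1 \<alpha>))\<^sup>2} \<times> {0..(Lsq_opnorm grid (shift2 \<beta>))\<^sup>2}) \<and>
     (\<forall>k1 k2. shift_moment \<alpha> \<beta> k1 k2 = (\<integral>x. fst x ^ k1 * snd x ^ k2 \<partial>\<mu>))"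

text \<open>The norm of the unilateral weighted shift with positive weights \<open>\<omega>\<close> is \<open>sup\<^sub>n \<omega>\<^sub>n\<close>.\<close>

definition is_berger_measure1 :: "(nat \<Rightarrow> real) \<Rightarrow> real measure \<Rightarrow> bool" where
  "is_berger_measure1 \<omega> \<sigma> \<longleftrightarrow>
     prob_space \<sigma> \<and> sets \<sigma> = sets borel \<and>
     (AE r in \<sigma>. r \<in> {0..(SUP n. \<omega> n)\<^sup>2}) \<and>
     (\<forall>k. (\<Prod>i<k. (\<omega> i)\<^sup>2) = (\<integral>r. r ^ k \<partial>\<sigma>))"

definition bergman_weight :: "nat \<Rightarrow> real" where
  "bergman_weight n = sqrt ((real n + 1) / (real n + 2))"

text \<open>
  The spherically isometric embedding of a unilateral weighted shift with Berger measure \<open>\<sigma>\<close> is the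
  2-variable weighted shift with moments \<open>\<integral> r\<^sup>k\<^sup>1 (1 - r)\<^sup>k\<^sup>2 d\<sigma>\<close>. Its (positive) weights are
  recovered from the moments by \<open>\<alpha>\<^sub>k\<^sup>2 = \<gamma>\<^sub>k\<^sub>+\<^sub>(\<^sub>1\<^sub>,\<^sub>0\<^sub>) / \<gamma>\<^sub>k\<close> and \<open>\<beta>\<^sub>k\<^sup>2 = \<gamma>\<^sub>k\<^sub>+\<^sub>(\<^sub>0\<^sub>,\<^sub>1\<^sub>) / \<gamma>\<^sub>k\<close>.
\<close>

definition sie_moment :: "real measure \<Rightarrow> nat \<Rightarrow> nat \<Rightarrow> real" where
  "sie_moment \<sigma> k1 k2 = (\<integral>r. r ^ k1 * (1 - r) ^ k2 \<partial>\<sigma>)"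

definition sie_alpha :: "real measure \<Rightarrow> nat \<Rightarrow> nat \<Rightarrow> real" where
  "sie_alpha \<sigma> k1 k2 = sqrt (sie_moment \<sigma> (k1 + 1) k2 / sie_moment \<sigma> k1 k2)"

definition sie_beta :: "real measure \<Rightarrow> nat \<Rightarrow> nat \<Rightarrow> real" where
  "sie_beta \<sigma> k1 k2 = sqrt (sie_moment \<sigma> k1 (k2 + 1) / sie_moment \<sigma> k1 k2)"

lemma Sup_bergman_weight: "(SUP n. bergman_weight n) = 1"
proof (rule LIMSEQ_unique[OF LIMSEQ_incseq_SUP])
  have le: "bergman_weight n \<le> 1" for n
    by (simp add: bergman_weight_def)
  show "bdd_above (range bergman_weight)"
    using le by (auto intro!: bdd_aboveI2)
  show "incseq bergman_weight"
    by (rule incseq_SucI) (auto simp: bergman_weight_def field_simps)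
  show "bergman_weight \<longlonglongrightarrow> 1"
    unfolding bergman_weight_def by real_asymp
qed

lemma prod_bergman_weight: "(\<Prod>i<k. (bergman_weight i)\<^sup>2) = 1 / (real k + 1)"
  by (induction k) (auto simp: bergman_weight_def field_simps)

lemma is_berger_measure1_bergman: "is_berger_measure1 bergman_weight (uniform_measure lborel {0..1})"
proof -
  have unif: "uniform_measure lborel {0..1::real} = density lborel (\<lambda>x. ennreal (indicator {0..1} x))"
    unfolding uniform_measure_def by (rule density_cong) (auto simp: indicator_def divide_ennreal)
  have mom: "1 / (real k + 1) = (\<integral>r. r ^ k \<partial>uniform_measure lborel {0..1})" for k
  proof -
    have "(\<integral>r. r ^ k \<partial>uniform_measure lborel {0..1}) = (LBINT r:{0..1}. (r::real) ^ k)"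
      unfolding unif set_lebesgue_integral_def by (rule integral_density) auto
    also have "\<dots> = 1 / (real k + 1)"
      unfolding set_lebesgue_integral_def using integral_power[of 0 1 k]
      by (simp add: mult.commute)
    finally show ?thesis ..
  qed
  have "AE r in uniform_measure lborel {0..1::real}. r \<in> {0..1}"
    by (intro AE_uniform_measureI) auto
  then show ?thesis
    using mom unfolding is_berger_measure1_def Sup_bergman_weight prod_bergman_weight
    by (auto intro!: prob_space_uniform_measure)
qed

lemma sie_moment_bergman:
  assumes "is_berger_measure1 bergman_weight \<sigma>"
  shows "sie_moment \<sigma> k1 k2 = fact k1 * fact k2 / fact (k1 + k2 + 1)"
proof -
  interpret prob_space \<sigma>
    using assms by (simp add: is_berger_measure1_def)
  have [measurable_cong]: "sets \<sigma> = sets borel"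
    and ae: "AE r in \<sigma>. r \<in> {0..1}"
    and mom: "\<And>k. (\<integral>r. r ^ k \<partial>\<sigma>) = 1 / (real k + 1)"
    using assms
    unfolding is_berger_measure1_def Sup_bergman_weight prod_bergman_weight by auto
  have int: "integrable \<sigma> (\<lambda>r. r ^ a * (1 - r) ^ b)" for a b
    by (rule integrable_const_bound[where B = 1])
      (use ae in \<open>auto simp: abs_mult power_abs intro!: mult_le_one power_le_one\<close>)
  have "sie_moment \<sigma> a b = fact a * fact b / fact (a + b + 1)" for a b
  proof (induction b arbitrary: a)
    case 0
    then show ?case by (simp add: sie_moment_def mom)
  next
    case (Suc b)
    have "sie_moment \<sigma> a (Suc b) = sie_moment \<sigma> a b - sie_moment \<sigma> (Suc a) b"
      unfolding sie_moment_def using int[of a b] int[of "Suc a" b]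
      by (subst Bochner_Integration.integral_diff[symmetric])
        (auto simp: algebra_simps intro!: Bochner_Integration.integral_cong)
    then show ?case
      by (simp add: Suc divide_simps) (simp add: algebra_simps)
  qed
  then show ?thesis .
qed

lemma sie_alpha_bergman:
  assumes "is_berger_measure1 bergman_weight \<sigma>"
  shows "sie_alpha \<sigma> k1 k2 = sqrt ((real k1 + 1) / (real k1 + real k2 + 2))"
  by (simp add: sie_alpha_def sie_moment_bergman[OF assms] divide_simps) (simp add: algebra_simps)

lemma sie_beta_bergman:
  assumes "is_berger_measure1 bergman_weight \<sigma>"
  shows "sie_beta \<sigma> k1 k2 = sqrt ((real k2 + 1) / (real k1 + real k2 + 2))"
  by (simp add: sie_beta_def sie_moment_bergman[OF assms] divide_simps) (simp add: algebra_simps)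

end

theory Submission
  imports Defs
begin

text \<open>
  The two claims rest on the same numbers \<open>a! b! / (a + b + 1)!\<close>. They are the moments of the shift,
  the moments of the uniform distribution on the segment, and the squared norms of the monomials
  \<open>z\<^sub>1\<^sup>a z\<^sub>2\<^sup>b\<close> on the sphere.

  Both normalized measures come from Hausdorff measures, which are countably additive on Borel sets
  by Caratheodory's criterion (\<open>emeasure_hausdorff_measure\<close>). On the segment, fine subdivisions and a
  Lipschitz coordinate bound the 1-dimensional measure from above and below, so normalized arclength
  is the image of the uniform distribution under \<open>r \<mapsto> (r, 1 - r)\<close> (\<open>normalized_arclength_L_eq\<close>). On
  the sphere no exact value of the 3-dimensional measure is needed: it is positive and finite, and
  the torus and the real rotations preserve it because they act by isometries.

  Berger measure: the moments of degree at most 2 force \<open>(s + t - 1)\<^sup>2\<close> to vanish almost everywhere,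
  so any Berger measure lives on the segment and is determined by its first marginal. The marginal
  has compact support, so its moments determine it (\<open>segment_measure_unique\<close>).

  Unitary equivalence: invariance under the torus makes the monomials orthogonal, and invariance
  under real rotations determines their norms. Expanding \<open>|u z\<^sub>1 + v z\<^sub>2|\<^sup>2\<^sup>n\<close> shows that
  \<open>binomial(n, k)\<close> times the squared norm of \<open>z\<^sub>1\<^sup>k z\<^sub>2\<^sup>n\<^sup>-\<^sup>k\<close> does not depend on \<open>k\<close>, and
  \<open>(|z\<^sub>1|\<^sup>2 + |z\<^sub>2|\<^sup>2)\<^sup>n = 1\<close> gives the common value \<open>1 / (n + 1)\<close> (\<open>surface_moment_eq\<close>). The
  normalized monomials are therefore an orthonormal basis of the Hardy space, and multiplication by
  a coordinate moves each of them to the next one with exactly the weight of the shift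
  (\<open>hardy_basis_mult1\<close>, \<open>hardy_basis_mult2\<close>). The unitary sends the unit vectors of \<open>\<ell>\<^sup>2\<close> to this
  basis; it is defined everywhere by the Riesz-Fischer theorem, and onto because every function in
  the Hardy space is the sum of its Fourier expansion (\<open>unitary_synthesis\<close>).
\<close>

section \<open>Hausdorff measure is a Borel measure\<close>

lemma diam_content_empty [simp]: "diam_content d {} = 0"
  by (simp add: diam_content_def)

lemma diameter_leI:
  assumes "0 \<le> \<delta>" "\<And>x y. x \<in> S \<Longrightarrow> y \<in> S \<Longrightarrow> dist x y \<le> \<delta>"
  shows "diameter S \<le> \<delta>"
  using assms unfolding diameter_def by (auto intro!: cSUP_least)

lemma diam_content_mono:
  assumes "A \<subseteq> B" "bounded B"
  shows "diam_content d A \<le> diam_content d B"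
proof -
  have "0 \<le> diameter A" "diameter A \<le> diameter B"
    using assms by (auto intro: diameter_ge_0 bounded_subset diameter_subset)
  then show ?thesis
    using assms(1) by (auto simp: diam_content_def intro!: ennreal_leI mult_left_mono power_mono)
qed

lemma hausdorff_pre_le_cover:
  fixes C :: "nat \<Rightarrow> 'a::metric_space set"
  assumes "A \<subseteq> (\<Union>i. C i)" "\<And>i. bounded (C i)" "\<And>i. diameter (C i) \<le> \<delta>"
  shows "hausdorff_pre d \<delta> A \<le> (\<Sum>i. diam_content d (C i))"
  unfolding hausdorff_pre_def by (rule INF_lower) (use assms in auto)

lemma hausdorff_pre_le_finite_cover:
  fixes C :: "'i \<Rightarrow> 'a::metric_space set"
  assumes "finite I" "0 < \<delta>" "A \<subseteq> (\<Union>i\<in>I. C i)"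
    and "\<And>i. i \<in> I \<Longrightarrow> bounded (C i)" "\<And>i. i \<in> I \<Longrightarrow> diameter (C i) \<le> \<delta>"
  shows "hausdorff_pre d \<delta> A \<le> (\<Sum>i\<in>I. diam_content d (C i))"
proof -
  obtain h where h: "bij_betw h {0..<card I} I"
    using ex_bij_betw_nat_finite[OF assms(1)] by blast
  have hI: "h n \<in> I" if "n < card I" for n
    using h that by (auto simp: bij_betw_def)
  \<comment> \<open>Empty sets, of content 0, extend the finite cover to a sequence.\<close>
  define C' where "C' = (\<lambda>n. if n < card I then C (h n) else {})"
  have "A \<subseteq> (\<Union>n. C' n)"
  proof
    fix x assume "x \<in> A"
    then obtain i where i: "i \<in> I" "x \<in> C i" using assms(3) by blast
    then obtain n where "n < card I" "h n = i"
      using h by (metis atLeastLessThan_iff bij_betw_iff_bijections)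
    then show "x \<in> (\<Union>n. C' n)" using i by (auto simp: C'_def)
  qed
  then have "hausdorff_pre d \<delta> A \<le> (\<Sum>n. diam_content d (C' n))"
    by (rule hausdorff_pre_le_cover) (use assms hI in \<open>auto simp: C'_def\<close>)
  also have "\<dots> = (\<Sum>n\<in>{0..<card I}. diam_content d (C' n))"
    by (rule suminf_finite) (auto simp: C'_def)
  also have "\<dots> = (\<Sum>n\<in>{0..<card I}. diam_content d (C (h n)))"
    by (rule sum.cong) (auto simp: C'_def)
  also have "\<dots> = (\<Sum>i\<in>I. diam_content d (C i))"
    by (rule sum.reindex_bij_betw[OF h])
  finally show ?thesis .
qed

lemma hausdorff_pre_mono: "A \<subseteq> B \<Longrightarrow> hausdorff_pre d \<delta> A \<le> hausdorff_pre d \<delta> B"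
  unfolding hausdorff_pre_def by (rule INF_superset_mono) auto

lemma hausdorff_pre_antimono: "\<delta> \<le> \<delta>' \<Longrightarrow> hausdorff_pre d \<delta>' A \<le> hausdorff_pre d \<delta> A"
  unfolding hausdorff_pre_def by (rule INF_superset_mono) (auto intro: order_trans)

lemma hausdorff_pre_le_outer: "0 < \<delta> \<Longrightarrow> hausdorff_pre d \<delta> A \<le> hausdorff_outer d A"
  unfolding hausdorff_outer_def by (rule SUP_upper) auto

lemma hausdorff_outer_leI:
  "(\<And>\<delta>. 0 < \<delta> \<Longrightarrow> hausdorff_pre d \<delta> A \<le> c) \<Longrightarrow> hausdorff_outer d A \<le> c"
  unfolding hausdorff_outer_def by (rule SUP_least) auto

lemma hausdorff_outer_mono: "A \<subseteq> B \<Longrightarrow> hausdorff_outer d A \<le> hausdorff_outer d B"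
  by (rule hausdorff_outer_leI) (meson hausdorff_pre_le_outer hausdorff_pre_mono order_trans)

lemma hausdorff_outer_empty [simp]: "hausdorff_outer d {} = 0"
proof -
  have "hausdorff_pre d \<delta> ({} :: 'a set) \<le> 0" if "0 < \<delta>" for \<delta>
    using hausdorff_pre_le_finite_cover[of "{}" \<delta> "{} :: 'a set" "\<lambda>_. {}" d] that by simp
  then have "hausdorff_outer d ({} :: 'a set) \<le> 0"
    by (rule hausdorff_outer_leI)
  then show ?thesis by simp
qed

lemma hausdorff_pre_countably_subadditive:
  fixes A :: "nat \<Rightarrow> 'a::metric_space set"
  shows "hausdorff_pre d \<delta> (\<Union>n. A n) \<le> (\<Sum>n. hausdorff_pre d \<delta> (A n))"
proof (rule ennreal_le_epsilon)
  fix e :: real assume e: "0 < e" and fin: "(\<Sum>n. hausdorff_pre d \<delta> (A n)) < top"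
  have "hausdorff_pre d \<delta> (A n) < hausdorff_pre d \<delta> (A n) + e * (1/2)^Suc n" for n
    using e fin by (auto simp add: less_top dest!: ennreal_suminf_lessD)
  then have "\<exists>C. A n \<subseteq> (\<Union>i. C i) \<and> (\<forall>i::nat. bounded (C i) \<and> diameter (C i) \<le> \<delta>) \<and>
      (\<Sum>i. diam_content d (C i)) < hausdorff_pre d \<delta> (A n) + e * (1/2)^Suc n" for n
    by (subst (asm) hausdorff_pre_def) (simp only: INF_less_iff mem_Collect_eq Bex_def conj_assoc)
  then obtain B where B: "\<And>n. A n \<subseteq> (\<Union>i::nat. B n i)"
      "\<And>n i. bounded (B n i)" "\<And>n i. diameter (B n i) \<le> \<delta>"
      "\<And>n. (\<Sum>i. diam_content d (B n i)) \<le> hausdorff_pre d \<delta> (A n) + e * (1/2)^Suc n"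
    by (metis less_imp_le)
  define C where "C = case_prod B \<circ> prod_decode"
  have "(\<Union>n. A n) \<subseteq> (\<Union>i. C i)"
    using B(1) by (auto simp add: C_def subset_eq) (metis prod.case prod_encode_inverse)
  then have "hausdorff_pre d \<delta> (\<Union>n. A n) \<le> (\<Sum>i. diam_content d (C i))"
    by (rule hausdorff_pre_le_cover) (use B in \<open>auto simp: C_def split: prod.split\<close>)
  also have "\<dots> = (\<Sum>n. \<Sum>i. diam_content d (B n i))"
    unfolding C_def comp_def by (intro suminf_ennreal_2dimen) auto
  also have "\<dots> \<le> (\<Sum>n. hausdorff_pre d \<delta> (A n) + e * (1/2) ^ Suc n)"
    by (intro suminf_le allI B) auto
  also have "\<dots> = (\<Sum>n. hausdorff_pre d \<delta> (A n)) + (\<Sum>n. ennreal e * ennreal ((1/2) ^ Suc n))"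
    using e by (subst suminf_add[symmetric])
      (auto simp del: ennreal_suminf_cmult simp add: ennreal_mult[symmetric])
  also have "\<dots> = (\<Sum>n. hausdorff_pre d \<delta> (A n)) + e"
    unfolding ennreal_suminf_cmult
    by (subst suminf_ennreal_eq[OF zero_le_power power_half_series]) auto
  finally show "hausdorff_pre d \<delta> (\<Union>n. A n) \<le> (\<Sum>n. hausdorff_pre d \<delta> (A n)) + e" .
qed

lemma hausdorff_outer_countably_subadditive:
  "hausdorff_outer d (\<Union>n::nat. A n) \<le> (\<Sum>n. hausdorff_outer d (A n))"
proof (rule hausdorff_outer_leI)
  fix \<delta> :: real assume \<delta>: "0 < \<delta>"
  have "hausdorff_pre d \<delta> (\<Union>n. A n) \<le> (\<Sum>n. hausdorff_pre d \<delta> (A n))"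
    by (rule hausdorff_pre_countably_subadditive)
  also have "\<dots> \<le> (\<Sum>n. hausdorff_outer d (A n))"
    by (intro suminf_le allI hausdorff_pre_le_outer \<delta>) auto
  finally show "hausdorff_pre d \<delta> (\<Union>n. A n) \<le> (\<Sum>n. hausdorff_outer d (A n))" .
qed

lemma outer_measure_space_hausdorff: "outer_measure_space (Pow UNIV) (hausdorff_outer d)"
  unfolding outer_measure_space_def positive_def increasing_def countably_subadditive_def
  by (auto intro: hausdorff_outer_mono hausdorff_outer_countably_subadditive)

lemma hausdorff_outer_Un: "hausdorff_outer d (A \<union> B) \<le> hausdorff_outer d A + hausdorff_outer d B"
proof -
  have "subadditive (Pow UNIV) (hausdorff_outer d :: 'a set \<Rightarrow> _)"
    by (rule ring_of_sets.countably_subadditive_subadditive[OF ring_of_sets_Pow])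
      (use outer_measure_space_hausdorff in \<open>auto simp: outer_measure_space_def\<close>)
  then show ?thesis
    unfolding subadditive_def
    by (metis Diff_disjoint Pow_UNIV UNIV_I Un_Diff_cancel add_left_mono
        hausdorff_outer_mono Diff_subset order_trans)
qed

text \<open>
  A set of diameter less than \<open>\<epsilon>\<close> meets at most one of two sets at distance \<open>\<epsilon>\<close>, so a fine cover
  of their union splits into covers of the two. This makes the outer measure a metric one.
\<close>

lemma hausdorff_outer_Un_separated:
  fixes A B :: "'a::metric_space set"
  assumes \<epsilon>: "0 < \<epsilon>" and sep: "\<And>x y. x \<in> A \<Longrightarrow> y \<in> B \<Longrightarrow> \<epsilon> \<le> dist x y"
  shows "hausdorff_outer d (A \<union> B) = hausdorff_outer d A + hausdorff_outer d B"
proof (rule antisym[OF hausdorff_outer_Un])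
  have main: "hausdorff_pre d \<delta> A + hausdorff_pre d \<delta> B \<le> hausdorff_outer d (A \<union> B)"
    if \<delta>: "0 < \<delta>" for \<delta>
  proof -
    define \<eta> where "\<eta> = min \<delta> (\<epsilon> / 2)"
    have \<eta>: "0 < \<eta>" "\<eta> \<le> \<delta>" "\<eta> < \<epsilon>" using \<delta> \<epsilon> by (auto simp: \<eta>_def)
    have "hausdorff_pre d \<delta> A + hausdorff_pre d \<delta> B \<le> hausdorff_pre d \<eta> (A \<union> B)"
      unfolding hausdorff_pre_def[of d \<eta>]
    proof (rule INF_greatest)
      fix C :: "nat \<Rightarrow> 'a set"
      assume "C \<in> {C. A \<union> B \<subseteq> (\<Union>i. C i) \<and> (\<forall>i. bounded (C i) \<and> diameter (C i) \<le> \<eta>)}"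
      then have C: "A \<subseteq> (\<Union>i. C i)" "B \<subseteq> (\<Union>i. C i)" "\<And>i. bounded (C i)"
        "\<And>i. diameter (C i) \<le> \<eta>" by auto
      have b: "bounded (C i \<inter> S)" "diameter (C i \<inter> S) \<le> \<delta>" for i S
        using C(3,4)[of i] \<eta>(2) diameter_subset[of "C i \<inter> S" "C i"] by (auto intro: bounded_subset)
      have "hausdorff_pre d \<delta> A \<le> (\<Sum>i. diam_content d (C i \<inter> A))"
        using C(1) by (intro hausdorff_pre_le_cover b) auto
      moreover have "hausdorff_pre d \<delta> B \<le> (\<Sum>i. diam_content d (C i \<inter> B))"
        using C(2) by (intro hausdorff_pre_le_cover b) auto
      ultimately have "hausdorff_pre d \<delta> A + hausdorff_pre d \<delta> B
          \<le> (\<Sum>i. diam_content d (C i \<inter> A)) + (\<Sum>i. diam_content d (C i \<inter> B))"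
        by (rule add_mono)
      also have "\<dots> = (\<Sum>i. diam_content d (C i \<inter> A) + diam_content d (C i \<inter> B))"
        by (rule suminf_add) auto
      also have "\<dots> \<le> (\<Sum>i. diam_content d (C i))"
      proof (intro suminf_le allI)
        fix i
        have "C i \<inter> A = {} \<or> C i \<inter> B = {}"
        proof (rule ccontr)
          assume "\<not> ?thesis"
          then obtain x y where "x \<in> C i" "x \<in> A" "y \<in> C i" "y \<in> B" by auto
          then show False
            using sep[of x y] diameter_bounded_bound[OF C(3)[of i], of x y] C(4)[of i] \<eta>(3)
            by auto
        qed
        then show "diam_content d (C i \<inter> A) + diam_content d (C i \<inter> B) \<le> diam_content d (C i)"
          using diam_content_mono[of "C i \<inter> A" "C i" d] diam_content_mono[of "C i \<inter> B" "C i" d]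
            C(3)[of i] by auto
      qed auto
      finally show "hausdorff_pre d \<delta> A + hausdorff_pre d \<delta> B \<le> (\<Sum>i. diam_content d (C i))" .
    qed
    also have "\<dots> \<le> hausdorff_outer d (A \<union> B)"
      by (rule hausdorff_pre_le_outer[OF \<eta>(1)])
    finally show ?thesis .
  qed
  have "hausdorff_outer d A + hausdorff_outer d B =
      (SUP \<delta>\<in>{0<..}. hausdorff_pre d \<delta> A + hausdorff_pre d \<delta> B)"
    unfolding hausdorff_outer_def
  proof (rule SUP_add_directed_ennreal[symmetric])
    fix i j :: real assume "i \<in> {0<..}" "j \<in> {0<..}"
    then show "\<exists>k\<in>{0<..}. hausdorff_pre d i A + hausdorff_pre d j B
        \<le> hausdorff_pre d k A + hausdorff_pre d k B"
      by (intro bexI[of _ "min i j"] add_mono hausdorff_pre_antimono) auto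
  qed 
  also have "\<dots> \<le> hausdorff_outer d (A \<union> B)"
    by (rule SUP_least) (use main in auto)
  finally show "hausdorff_outer d A + hausdorff_outer d B \<le> hausdorff_outer d (A \<union> B)" .
qed

text \<open>
  Caratheodory's criterion for a closed set \<open>C\<close>: cutting off the points of \<open>T - C\<close> at distance less
  than \<open>1 / (n + 1)\<close> from \<open>C\<close> leaves a set separated from \<open>C\<close>. What is cut off is a union of
  shells \<open>R k\<close> around \<open>C\<close>. Shells that are not adjacent are separated, so the shells of even index
  and those of odd index each have total measure at most that of \<open>T\<close>, and the tails vanish.
\<close>

lemma closed_in_lambda_system_hausdorff:
  fixes C :: "'a::metric_space set"
  assumes C: "closed C"
  shows "C \<in> lambda_system UNIV (Pow UNIV) (hausdorff_outer d)"
proof -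
  let ?H = "hausdorff_outer d :: 'a set \<Rightarrow> ennreal"
  have le: "?H (T \<inter> C) + ?H (T - C) \<le> ?H T" for T
  proof (cases "C = {} \<or> ?H T = top")
    case False
    then have ne: "C \<noteq> {}" and fin: "?H T < top" by (auto simp: less_top)
    define u where "u = (\<lambda>x. infdist x C)"
    have upos: "0 < u x" if "x \<notin> C" for x
      using infdist_pos_not_in_closed[OF C ne that] by (simp add: u_def)
    have ulip: "u x - u y \<le> dist x y" for x y
      using infdist_triangle[of x C y] by (simp add: u_def)
    define D where "D = (\<lambda>n::nat. {x \<in> T - C. 1 / (real n + 1) \<le> u x})"
    define R where "R = (\<lambda>n::nat. {x \<in> T - C. 1 / (real n + 2) \<le> u x \<and> u x < 1 / (real n + 1)})"
    have D: "?H (T \<inter> C) + ?H (D n) \<le> ?H T" for n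
    proof -
      have "?H (T \<inter> C \<union> D n) = ?H (T \<inter> C) + ?H (D n)"
      proof (rule hausdorff_outer_Un_separated[of "1 / (real n + 1)"])
        fix x y assume "x \<in> T \<inter> C" "y \<in> D n"
        then show "1 / (real n + 1) \<le> dist x y"
          using infdist_le[of x C y] by (auto simp: D_def u_def dist_commute)
      qed simp
      moreover have "?H (T \<inter> C \<union> D n) \<le> ?H T"
        by (rule hausdorff_outer_mono) (auto simp: D_def)
      ultimately show ?thesis by simp
    qed
    have shells: "(\<Sum>k<N. ?H (R (2 * k + p))) \<le> ?H T" for N p :: nat
    proof -
      have "(\<Sum>k<N. ?H (R (2 * k + p))) = ?H (\<Union>k<N. R (2 * k + p))"
      proof (induction N)
        case (Suc N)
        have "?H ((\<Union>k<N. R (2 * k + p)) \<union> R (2 * N + p))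
            = ?H (\<Union>k<N. R (2 * k + p)) + ?H (R (2 * N + p))"
        proof (cases "N = 0")
          case False
          show ?thesis
          proof (rule hausdorff_outer_Un_separated
              [of "1 / (real (2 * N + p)) - 1 / (real (2 * N + p) + 1)"])
            show "0 < 1 / real (2 * N + p) - 1 / (real (2 * N + p) + 1)"
              using False by (auto intro!: divide_strict_left_mono)
            fix x y assume "x \<in> (\<Union>k<N. R (2 * k + p))" and y: "y \<in> R (2 * N + p)"
            then obtain k where k: "k < N" "x \<in> R (2 * k + p)" by auto
            have "1 / real (2 * N + p) \<le> 1 / (real (2 * k + p) + 2)"
              using k(1) by (intro divide_left_mono) auto
            also have "\<dots> \<le> u x" using k(2) by (auto simp: R_def)
            finally have "1 / real (2 * N + p) \<le> u x" .
            moreover have "u y < 1 / (real (2 * N + p) + 1)" using y by (auto simp: R_def)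
            ultimately show "1 / (real (2 * N + p)) - 1 / (real (2 * N + p) + 1) \<le> dist x y"
              using ulip[of x y] by linarith
          qed
        qed simp
        then show ?case
          using Suc by (simp add: lessThan_Suc Un_commute add.commute)
      qed simp
      also have "\<dots> \<le> ?H T"
        by (rule hausdorff_outer_mono) (auto simp: R_def)
      finally show ?thesis .
    qed
    have "(\<Sum>k<n. ?H (R k)) \<le> ?H T + ?H T" for n
    proof -
      have "(\<Sum>k<2 * n. ?H (R k)) = (\<Sum>k<n. ?H (R (2 * k + 0))) + (\<Sum>k<n. ?H (R (2 * k + 1)))"
        by (induction n) (auto simp: algebra_simps)
      also have "\<dots> \<le> ?H T + ?H T"
        by (intro add_mono shells)
      finally have "(\<Sum>k<2 * n. ?H (R k)) \<le> ?H T + ?H T" .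
      moreover have "(\<Sum>k<n. ?H (R k)) \<le> (\<Sum>k<2 * n. ?H (R k))"
        by (rule sum_mono2) auto
      ultimately show ?thesis by (rule order_trans[rotated])
    qed
    then have "(\<Sum>k. ?H (R k)) \<le> ?H T + ?H T"
      by (intro suminf_le_const) auto
    also have "\<dots> < top" using fin by simp
    finally have sum_fin: "(\<Sum>k. ?H (R k)) < top" .
    define r where "r = (\<lambda>k. enn2real (?H (R k)))"
    have r: "?H (R k) = ennreal (r k)" for k
      using fin hausdorff_outer_mono[of "R k" T d]
      by (auto simp: r_def R_def order.strict_trans1 intro!: ennreal_enn2real[symmetric])
    have r0: "0 \<le> r k" for k by (simp add: r_def)
    have sr: "summable r"
      using sum_fin unfolding r by (intro summable_suminf_not_top r0) auto
    show ?thesis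
    proof (rule ennreal_le_epsilon)
      fix e :: real assume e: "0 < e"
      have "(\<lambda>n. \<Sum>k. r (k + n)) \<longlonglongrightarrow> 0"
        by (rule suminf_exist_split2[OF sr])
      then obtain n where n: "(\<Sum>k. r (k + n)) < e"
        using e by (metis (no_types, lifting) eventually_happens order_tendstoD(2) sequentially_bot)
      have sub: "T - C \<subseteq> D n \<union> (\<Union>k. R (k + n))"
      proof
        fix x assume x: "x \<in> T - C"
        then have ux: "0 < u x" using upos by auto
        show "x \<in> D n \<union> (\<Union>k. R (k + n))"
        proof (cases "1 / (real n + 1) \<le> u x")
          case False
          \<comment> \<open>The shell of \<open>x\<close> is found by rounding \<open>1 / u x\<close> up to an integer.\<close>
          define m where "m = (LEAST m. 1 / (real m + 2) \<le> u x)"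
          obtain m0 where "1 / (real (Suc m0)) < u x"
            using nat_approx_posE[OF ux] by metis
          moreover have "1 / (real m0 + 2) \<le> 1 / (real (Suc m0))"
            by (intro divide_left_mono) auto
          ultimately have ex: "1 / (real m0 + 2) \<le> u x" by linarith
          have m1: "1 / (real m + 2) \<le> u x"
            unfolding m_def by (rule LeastI[of "\<lambda>m. 1 / (real m + 2) \<le> u x", OF ex])
          have nm: "n \<le> m"
          proof (rule ccontr)
            assume "\<not> n \<le> m"
            then have "1 / (real n + 1) \<le> 1 / (real m + 2)"
              by (intro divide_left_mono) auto
            then show False using m1 False by linarith
          qed
          have m2: "u x < 1 / (real m + 1)"
          proof (cases "m = n")
            case False
            then have "\<not> 1 / (real (m - 1) + 2) \<le> u x"
              using nm not_less_Least[of "m - 1" "\<lambda>m. 1 / (real m + 2) \<le> u x"] by (simp add: m_def)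
            then show ?thesis using False nm by (simp add: of_nat_diff add.commute not_le)
          qed (use \<open>\<not> 1 / (real n + 1) \<le> u x\<close> in auto)
          have "x \<in> R (m - n + n)" using m1 m2 x nm by (auto simp: R_def)
          then show ?thesis by blast
        qed (use x in \<open>auto simp: D_def\<close>)
      qed
      have "?H (T - C) \<le> ?H (D n \<union> (\<Union>k. R (k + n)))"
        by (rule hausdorff_outer_mono[OF sub])
      also have "\<dots> \<le> ?H (D n) + ?H (\<Union>k. R (k + n))"
        by (rule hausdorff_outer_Un)
      also have "\<dots> \<le> ?H (D n) + (\<Sum>k. ?H (R (k + n)))"
        by (intro add_left_mono hausdorff_outer_countably_subadditive)
      also have "(\<Sum>k. ?H (R (k + n))) = ennreal (\<Sum>k. r (k + n))"
        unfolding r using sr r0 by (intro suminf_ennreal2) (auto simp: summable_iff_shift)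
      also have "\<dots> \<le> ennreal e"
        using n by (intro ennreal_leI) simp
      finally have "?H (T - C) \<le> ?H (D n) + e" by (simp add: add_left_mono)
      then have "?H (T \<inter> C) + ?H (T - C) \<le> ?H (T \<inter> C) + ?H (D n) + e"
        by (simp add: add.assoc add_left_mono)
      also have "\<dots> \<le> ?H T + e"
        by (intro add_right_mono D)
      finally show "?H (T \<inter> C) + ?H (T - C) \<le> ?H T + e" .
    qed
  qed auto
  have "?H (T \<inter> C) + ?H (T - C) = ?H T" for T
    using hausdorff_outer_Un[of d "T \<inter> C" "T - C"]
    by (intro antisym[OF le]) (simp add: Int_Diff_Un)
  then show ?thesis
    by (simp add: algebra.lambda_system_eq[OF algebra_Pow, of UNIV, simplified])
qed

lemma sets_hausdorff_measure [simp, measurable_cong]: "sets (hausdorff_measure d) = sets borel"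
  unfolding hausdorff_measure_def
  by (simp add: sets.sigma_sets_eq[of borel, unfolded space_borel] sets_measure_of_conv)

lemma space_hausdorff_measure [simp]: "space (hausdorff_measure d) = UNIV"
  unfolding hausdorff_measure_def by (simp add: space_measure_of_conv)

lemma emeasure_hausdorff_measure:
  fixes A :: "'a::metric_space set"
  assumes "A \<in> sets borel"
  shows "emeasure (hausdorff_measure d) A = hausdorff_outer d A"
proof -
  let ?L = "lambda_system UNIV (Pow UNIV) (hausdorff_outer d) :: 'a set set"
  interpret P: sigma_algebra "UNIV :: 'a set" "Pow UNIV"
    by (rule sigma_algebra_Pow)
  have L: "measure_space UNIV ?L (hausdorff_outer d)"
    by (rule P.caratheodory_lemma[OF outer_measure_space_hausdorff])
  then have sa: "sigma_algebra UNIV ?L"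
    by (simp add: measure_space_def)
  have "sigma_sets UNIV {S :: 'a set. closed S} \<subseteq> ?L"
    by (rule sigma_algebra.sigma_sets_subset[OF sa]) (use closed_in_lambda_system_hausdorff in auto)
  then have sub: "sets borel \<subseteq> ?L"
    by (simp add: borel_eq_closed)
  have "measure_space UNIV (sets borel :: 'a set set) (hausdorff_outer d)"
    using measure_down[OF L _ sub] sets.sigma_algebra_axioms[of "borel :: 'a measure"] by simp
  then show ?thesis
    unfolding hausdorff_measure_def using assms
    by (intro emeasure_measure_of_sigma) (auto simp: measure_space_def)
qed

lemma diameter_image_nonexpansive:
  assumes "bounded S" and f: "\<And>x y. dist (f x) (f y) \<le> dist x y"
  shows "bounded (f ` S)" "diameter (f ` S) \<le> diameter S"
proof -
  obtain a e where "\<forall>x\<in>S. dist a x \<le> e" using assms(1) by (auto simp: bounded_def)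
  then show "bounded (f ` S)"
    unfolding bounded_def using f order_trans by blast
  show "diameter (f ` S) \<le> diameter S"
    using assms(1) diameter_ge_0 by (intro diameter_leI)
      (auto intro: order_trans[OF f diameter_bounded_bound])
qed

lemma hausdorff_outer_nonexpansive_image:
  fixes f :: "'a::metric_space \<Rightarrow> 'b::metric_space"
  assumes f: "\<And>x y. dist (f x) (f y) \<le> dist x y"
  shows "hausdorff_outer d (f ` A) \<le> hausdorff_outer d A"
proof (rule hausdorff_outer_leI)
  fix \<delta> :: real assume \<delta>: "0 < \<delta>"
  have "hausdorff_pre d \<delta> (f ` A) \<le> hausdorff_pre d \<delta> A"
    unfolding hausdorff_pre_def[of d \<delta> A]
  proof (rule INF_greatest)
    fix C :: "nat \<Rightarrow> 'a set"
    assume "C \<in> {C. A \<subseteq> (\<Union>i. C i) \<and> (\<forall>i. bounded (C i) \<and> diameter (C i) \<le> \<delta>)}"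
    then have C: "A \<subseteq> (\<Union>i. C i)" "\<And>i. bounded (C i)" "\<And>i. diameter (C i) \<le> \<delta>" by auto
    have "hausdorff_pre d \<delta> (f ` A) \<le> (\<Sum>i. diam_content d (f ` C i))"
    proof (rule hausdorff_pre_le_cover)
      show "f ` A \<subseteq> (\<Union>i. f ` C i)" using C(1) by blast
      show "diameter (f ` C i) \<le> \<delta>" for i
        using diameter_image_nonexpansive(2)[of "C i" f, OF C(2) f] C(3)[of i] by linarith
    qed (rule diameter_image_nonexpansive(1)[OF C(2) f])
    also have "\<dots> \<le> (\<Sum>i. diam_content d (C i))"
      using diameter_image_nonexpansive[of "C _" f, OF C(2) f]
      by (intro suminf_le allI)
        (auto simp: diam_content_def intro!: ennreal_leI mult_left_mono power_mono diameter_ge_0)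
    finally show "hausdorff_pre d \<delta> (f ` A) \<le> (\<Sum>i. diam_content d (C i))" .
  qed
  also have "\<dots> \<le> hausdorff_outer d A"
    by (rule hausdorff_pre_le_outer[OF \<delta>])
  finally show "hausdorff_pre d \<delta> (f ` A) \<le> hausdorff_outer d A" .
qed

section \<open>Arclength on the segment\<close>

text \<open>
  The mass distribution principle: if the content of every set \<open>C\<close> is at least \<open>c\<close> times the
  \<open>N\<close>-mass that \<open>C\<close> covers through \<open>g\<close>, then the same holds for the total content of every cover.
\<close>

lemma emeasure_le_hausdorff_outer:
  fixes g :: "'a::metric_space \<Rightarrow> 'b" and c :: ennreal
  assumes B: "B \<subseteq> g ` A"
    and mass: "\<And>C. bounded C \<Longrightarrow> C \<noteq> {} \<Longrightarrow>
      \<exists>J\<in>sets N. g ` C \<subseteq> J \<and> c * emeasure N J \<le> diam_content d C"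
  shows "c * emeasure N B \<le> hausdorff_outer d A"
proof -
  have "c * emeasure N B \<le> (\<Sum>i. diam_content d (C i))"
    if C: "A \<subseteq> (\<Union>i. C i)" "\<And>i. bounded (C i)" for C :: "nat \<Rightarrow> 'a set"
  proof -
    have "\<exists>J\<in>sets N. g ` C i \<subseteq> J \<and> c * emeasure N J \<le> diam_content d (C i)" for i
      using mass[of "C i"] C(2)[of i] by (cases "C i = {}") auto
    then obtain J where J: "\<And>i. J i \<in> sets N" "\<And>i. g ` C i \<subseteq> J i"
        "\<And>i. c * emeasure N (J i) \<le> diam_content d (C i)"
      by metis
    have "B \<subseteq> (\<Union>i. J i)"
    proof
      fix y assume "y \<in> B"
      then obtain x where x: "x \<in> A" "y = g x" using B by blast
      then obtain i where "x \<in> C i" using C(1) by blast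
      then show "y \<in> (\<Union>i. J i)" using x J(2)[of i] by blast
    qed
    then have "emeasure N B \<le> emeasure N (\<Union>i. J i)"
      using J(1) by (intro emeasure_mono) auto
    also have "\<dots> \<le> (\<Sum>i. emeasure N (J i))"
      using J(1) by (intro emeasure_subadditive_countably) auto
    finally have "c * emeasure N B \<le> c * (\<Sum>i. emeasure N (J i))"
      by (rule mult_left_mono) simp
    also have "\<dots> = (\<Sum>i. c * emeasure N (J i))" by simp
    also have "\<dots> \<le> (\<Sum>i. diam_content d (C i))"
      by (intro suminf_le allI J) auto
    finally show ?thesis .
  qed
  then have "c * emeasure N B \<le> hausdorff_pre d 1 A"
    unfolding hausdorff_pre_def by (intro INF_greatest) auto
  also have "\<dots> \<le> hausdorff_outer d A"
    by (intro hausdorff_pre_le_outer) auto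
  finally show ?thesis .
qed

text \<open>Two probability measures, one of which dominates the other, agree: compare complements.\<close>

lemma prob_space_eqI_le:
  assumes M: "prob_space M" and N: "prob_space N" and sets: "sets M = sets N"
    and le: "\<And>A. A \<in> sets M \<Longrightarrow> emeasure M A \<le> emeasure N A"
  shows "M = N"
proof (rule measure_eqI[OF sets])
  interpret M: prob_space M by fact
  interpret N: prob_space N by fact
  have le': "measure M A \<le> measure N A" if "A \<in> sets M" for A
    using le[OF that] by (simp add: M.emeasure_eq_measure N.emeasure_eq_measure)
  fix A assume A: "A \<in> sets M"
  have "measure M (space M - A) \<le> measure N (space N - A)"
    using le'[of "space M - A"] A sets.compl_sets[OF A] sets_eq_imp_space_eq[OF sets] by simp
  then have "measure N A \<le> measure M A"
    using A sets M.prob_compl[of A] N.prob_compl[of A] by auto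
  then show "emeasure M A = emeasure N A"
    using le'[OF A] by (simp add: M.emeasure_eq_measure N.emeasure_eq_measure)
qed

lemma dist_segment_points: "dist (a, 1 - a) (b, 1 - b) = sqrt 2 * \<bar>a - b\<bar>" for a b :: real
proof -
  have "(dist (1 - a) (1 - b))\<^sup>2 = (a - b)\<^sup>2" "(dist a b)\<^sup>2 = (a - b)\<^sup>2"
    by (auto simp: dist_real_def power2_commute)
  then have "dist (a, 1 - a) (b, 1 - b) = sqrt (2 * (a - b)\<^sup>2)"
    by (simp add: dist_Pair_Pair)
  then show ?thesis by (simp add: real_sqrt_mult)
qed

lemma segment_L_eq: "segment_L = (\<lambda>r. (r, 1 - r)) ` {0..1}"
  by (auto simp: segment_L_def)

lemma closed_segment_L: "closed segment_L"
  unfolding segment_L_eq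
  by (intro compact_imp_closed compact_continuous_image continuous_intros compact_Icc)

lemma diam_content_1: "bounded S \<Longrightarrow> diam_content 1 S = ennreal (diameter S)"
  by (simp add: diam_content_def)

lemma unit_interval_grid:
  assumes "0 < N" "0 \<le> r" "r \<le> 1"
  shows "\<exists>i<N. real i / N \<le> r \<and> r \<le> (real i + 1) / N"
proof (cases "r = 1")
  case True
  then show ?thesis
    using assms(1) by (intro exI[of _ "N - 1"]) (auto simp: of_nat_diff field_simps)
next
  case False
  define i where "i = nat \<lfloor>r * N\<rfloor>"
  have "0 \<le> r * N" using assms by simp
  then have i: "real i \<le> r * N" "r * N < real i + 1"
    unfolding i_def by linarith+
  moreover have "r * N < N" using False assms by auto
  ultimately have "i < N" by linarith
  then show ?thesis
    using i assms(1) by (intro exI[of _ i]) (auto simp: field_simps)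
qed

text \<open>Cutting the segment into \<open>N\<close> equal pieces gives covers of total length \<open>sqrt 2\<close>.\<close>

lemma hausdorff_outer_segment_L_le: "hausdorff_outer 1 segment_L \<le> ennreal (sqrt 2)"
proof (rule hausdorff_outer_leI)
  fix \<delta> :: real assume \<delta>: "0 < \<delta>"
  define N where "N = nat \<lceil>sqrt 2 / \<delta>\<rceil>"
  have "0 < sqrt 2 / \<delta>" using \<delta> by simp
  then have N: "0 < N" "sqrt 2 / \<delta> \<le> real N"
    unfolding N_def by (linarith, simp add: of_nat_ceiling)
  then have N\<delta>: "sqrt 2 / N \<le> \<delta>"
    using \<delta> by (simp add: field_simps)
  define C where "C = (\<lambda>i. (\<lambda>r. (r, 1 - r)) ` {real i / N .. (real i + 1) / N})"
  have dC: "diameter (C i) \<le> sqrt 2 / N" for i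
  proof (rule diameter_leI)
    fix x y assume "x \<in> C i" "y \<in> C i"
    then obtain a b where ab: "x = (a, 1 - a)" "y = (b, 1 - b)"
      "a \<in> {real i / N .. (real i + 1) / N}" "b \<in> {real i / N .. (real i + 1) / N}"
      by (auto simp: C_def)
    then have "\<bar>a - b\<bar> \<le> 1 / N" by (auto simp: add_divide_distrib)
    then have "sqrt 2 * \<bar>a - b\<bar> \<le> sqrt 2 * (1 / N)" by (intro mult_left_mono) auto
    then show "dist x y \<le> sqrt 2 / N" using ab by (simp add: dist_segment_points)
  qed simp
  have bC: "bounded (C i)" for i
    unfolding C_def
    by (intro compact_imp_bounded compact_continuous_image continuous_intros compact_Icc)
  have cover: "segment_L \<subseteq> (\<Union>i\<in>{..<N}. C i)"
  proof
    fix x assume "x \<in> segment_L"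
    then obtain r where r: "x = (r, 1 - r)" "0 \<le> r" "r \<le> 1" by (auto simp: segment_L_def)
    then obtain i where "i < N" "real i / N \<le> r" "r \<le> (real i + 1) / N"
      using unit_interval_grid N(1) by metis
    then have "x \<in> C i" using r by (auto simp: C_def)
    then show "x \<in> (\<Union>i\<in>{..<N}. C i)" using \<open>i < N\<close> by blast
  qed
  have "hausdorff_pre 1 \<delta> segment_L \<le> (\<Sum>i<N. diam_content 1 (C i))"
    using cover bC dC N\<delta> \<delta> by (intro hausdorff_pre_le_finite_cover) (auto intro: order_trans)
  also have "\<dots> \<le> (\<Sum>i<N. ennreal (sqrt 2 / N))"
    unfolding diam_content_1[OF bC] using dC by (intro sum_mono ennreal_leI)
  also have "\<dots> = ennreal (sqrt 2)"
    using N(1) by (subst sum_ennreal) auto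
  finally show "hausdorff_pre 1 \<delta> segment_L \<le> ennreal (sqrt 2)" .
qed

text \<open>
  The coordinate \<open>(x, y) \<mapsto> (1 + x - y) / 2\<close> recovers \<open>r\<close> from \<open>(r, 1 - r)\<close> and shrinks distances
  in the whole plane by the factor \<open>\<surd>2\<close>, which is what makes the lower bound sharp.
\<close>

lemma lborel_le_hausdorff_outer_segment:
  fixes B :: "real set"
  shows "ennreal (sqrt 2) * emeasure lborel B \<le> hausdorff_outer 1 ((\<lambda>r. (r, 1 - r)) ` B)"
proof (rule emeasure_le_hausdorff_outer)
  define g :: "real \<times> real \<Rightarrow> real" where "g = (\<lambda>(x, y). (1 + x - y) / 2)"
  show "B \<subseteq> (\<lambda>(x, y). (1 + x - y) / 2) ` (\<lambda>r. (r, 1 - r)) ` B"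
    by (force simp: image_image)
  fix C :: "(real \<times> real) set" assume C: "bounded C" "C \<noteq> {}"
  have lip: "g p - g q \<le> diameter C / sqrt 2" if "p \<in> C" "q \<in> C" for p q
  proof -
    obtain x y x' y' where pq: "p = (x, y)" "q = (x', y')" by fastforce
    have "g p - g q = ((x - x') - (y - y')) / 2"
      by (simp add: pq g_def diff_divide_distrib add_divide_distrib)
    then have "2 * ((g p - g q) * sqrt 2)^2 = ((x - x') - (y - y'))^2"
      by (simp only: power_mult_distrib power_divide) simp
    also have "\<dots> \<le> 2 * ((x - x')^2 + (y - y')^2)"
      using sum_squares_ge_zero[of "x - x' + (y - y')" 0] by (simp add: power2_eq_square algebra_simps)
    also have "\<dots> = 2 * (dist p q)^2"
      by (simp add: pq dist_Pair_Pair dist_real_def)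
    finally have "((g p - g q) * sqrt 2)^2 \<le> (dist p q)^2"
      by (rule mult_left_le_imp_le) simp
    then have "(g p - g q) * sqrt 2 \<le> dist p q"
      by (rule power2_le_imp_le) simp
    also have "\<dots> \<le> diameter C" by (rule diameter_bounded_bound[OF C(1) that])
    finally show ?thesis by (simp add: pos_le_divide_eq)
  qed
  define l where "l = Inf (g ` C)"
  obtain p0 where p0: "p0 \<in> C" using C(2) by blast
  have bdd: "bdd_below (g ` C)"
    unfolding bdd_below_def using lip[OF p0] by (intro exI[of _ "g p0 - diameter C / sqrt 2"]) (auto simp: algebra_simps)
  have "g ` C \<subseteq> {l..l + diameter C / sqrt 2}"
  proof
    fix y assume "y \<in> g ` C"
    then obtain p where p: "p \<in> C" "y = g p" by auto
    have "l \<le> y" unfolding l_def using bdd p by (auto intro: cInf_lower)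
    moreover have "y - diameter C / sqrt 2 \<le> l"
      unfolding l_def using C(2) lip[OF p(1)] p(2) by (intro cInf_greatest) (auto simp: algebra_simps)
    ultimately show "y \<in> {l..l + diameter C / sqrt 2}" by auto
  qed
  moreover have "ennreal (sqrt 2) * emeasure lborel {l..l + diameter C / sqrt 2} = diam_content 1 C"
    using diameter_ge_0[OF C(1)] by (simp add: diam_content_1[OF C(1)] ennreal_mult[symmetric] del: One_nat_def)
  ultimately show "\<exists>J\<in>sets lborel. (\<lambda>(x, y). (1 + x - y) / 2) ` C \<subseteq> J \<and>
      ennreal (sqrt 2) * emeasure lborel J \<le> diam_content 1 C"
    unfolding g_def by (intro bexI[of _ "{l..l + diameter C / sqrt 2}"]) auto
qed

lemma hausdorff_outer_segment_L: "hausdorff_outer 1 segment_L = ennreal (sqrt 2)"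
proof (rule antisym[OF hausdorff_outer_segment_L_le])
  show "ennreal (sqrt 2) \<le> hausdorff_outer 1 segment_L"
    using lborel_le_hausdorff_outer_segment[of "{0..1}"] by (simp add: segment_L_eq)
qed

lemma normalized_arclength_L_eq:
  "normalized_arclength_L = distr (uniform_measure lborel {0..1}) borel (\<lambda>r. (r, 1 - r))"
proof (rule prob_space_eqI_le[symmetric])
  let ?\<phi> = "\<lambda>r :: real. (r, 1 - r)"
  have [measurable]: "?\<phi> \<in> borel_measurable borel" 
    by (intro borel_measurable_continuous_onI continuous_intros)
  have [measurable]: "segment_L \<in> sets borel"
    using closed_segment_L by simp
  have emL: "emeasure (hausdorff_measure 1) segment_L = ennreal (sqrt 2)"
    using hausdorff_outer_segment_L by (simp add: emeasure_hausdorff_measure)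
  interpret U: prob_space "uniform_measure lborel {0..1::real}"
    by (rule prob_space_uniform_measure) auto
  show "prob_space (distr (uniform_measure lborel {0..1}) borel ?\<phi>)"
    by (rule U.prob_space_distr) simp
  show "prob_space normalized_arclength_L"
    unfolding normalized_arclength_L_def by (rule prob_space_uniform_measure) (auto simp: emL simp del: One_nat_def)
  show "sets (distr (uniform_measure lborel {0..1}) borel ?\<phi>) = sets normalized_arclength_L"
    by (simp add: normalized_arclength_L_def)
  fix A assume "A \<in> sets (distr (uniform_measure lborel {0..1}) borel ?\<phi>)"
  then have A [measurable]: "A \<in> sets borel" by simp
  have [measurable]: "?\<phi> -` A \<in> sets borel"
    using measurable_sets[of ?\<phi> borel borel A] by simp
  have im: "?\<phi> ` ({0..1} \<inter> ?\<phi> -` A) = segment_L \<inter> A"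
    by (auto simp: segment_L_eq)
  have "emeasure (distr (uniform_measure lborel {0..1}) borel ?\<phi>) A
      = emeasure lborel ({0..1} \<inter> ?\<phi> -` A)"
    by (simp add: emeasure_distr emeasure_uniform_measure divide_ennreal_def)
  also have "\<dots> = emeasure lborel ({0..1} \<inter> ?\<phi> -` A) * ennreal (sqrt 2) / ennreal (sqrt 2)"
    by (rule ennreal_mult_divide_eq[symmetric]) auto
  also have "\<dots> \<le> hausdorff_outer 1 (segment_L \<inter> A) / ennreal (sqrt 2)"
    using lborel_le_hausdorff_outer_segment[of "{0..1} \<inter> ?\<phi> -` A"] unfolding im
    by (intro divide_right_mono_ennreal) (simp add: mult.commute)
  also have "\<dots> = emeasure normalized_arclength_L A"
    unfolding normalized_arclength_L_def
    by (subst emeasure_uniform_measure) (simp_all add: emL emeasure_hausdorff_measure del: One_nat_def)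
  finally show "emeasure (distr (uniform_measure lborel {0..1}) borel ?\<phi>) A
      \<le> emeasure normalized_arclength_L A" .
qed

section \<open>Surface measure on the sphere\<close>

lemma closed_sphere_S3: "closed sphere_S3"
proof -
  have "sphere_S3 = {z. (cmod (fst z))\<^sup>2 + (cmod (snd z))\<^sup>2 = 1}"
    by (auto simp: sphere_S3_def)
  also have "closed \<dots>"
    by (intro closed_Collect_eq continuous_intros)
  finally show ?thesis .
qed

lemma borel_sphere_S3 [measurable]: "sphere_S3 \<in> sets borel"
  using closed_sphere_S3 by simp

text \<open>
  A Lipschitz image of a 3-dimensional cube has finite 3-dimensional measure: the images of the
  \<open>N\<^sup>3\<close> cubes of side \<open>1 / N\<close> have total content independent of \<open>N\<close>.
\<close>

lemma hausdorff_outer_3_lipschitz_cube: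
  fixes f :: "real \<Rightarrow> real \<Rightarrow> real \<Rightarrow> 'a::metric_space"
  assumes f: "\<And>a b c a' b' c'. dist (f a b c) (f a' b' c') \<le> K * (\<bar>a - a'\<bar> + \<bar>b - b'\<bar> + \<bar>c - c'\<bar>)"
    and K: "0 < K"
    and A: "\<And>x. x \<in> A \<Longrightarrow> \<exists>a\<in>{0..1}. \<exists>b\<in>{0..1}. \<exists>c\<in>{0..1}. x = f a b c"
  shows "hausdorff_outer 3 A \<le> ennreal (unit_ball_vol 3 * (3 * K / 2) ^ 3)"
proof (rule hausdorff_outer_leI)
  fix \<delta> :: real assume \<delta>: "0 < \<delta>"
  define N where "N = nat \<lceil>3 * K / \<delta>\<rceil>"
  have "0 < 3 * K / \<delta>" using \<delta> K by simp
  then have N: "0 < N" "3 * K / \<delta> \<le> real N"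
    unfolding N_def by (linarith, simp add: of_nat_ceiling)
  then have N\<delta>: "3 * K / N \<le> \<delta>"
    using \<delta> by (simp add: field_simps)
  define I where "I = (\<lambda>i. {real i / N .. (real i + 1) / N})"
  have I: "\<bar>a - b\<bar> \<le> 1 / N" if "a \<in> I i" "b \<in> I i" for a b i
    using that by (auto simp: I_def add_divide_distrib)
  define C where "C = (\<lambda>(i, j, k). {f a b c | a b c. a \<in> I i \<and> b \<in> I j \<and> c \<in> I k})"
  have d: "dist x y \<le> 3 * K / N" if "x \<in> C p" "y \<in> C p" for x y p
  proof -
    obtain i j k where p: "p = (i, j, k)" by (cases p)
    from that obtain a b c a' b' c' where
      *: "x = f a b c" "y = f a' b' c'" "a \<in> I i" "a' \<in> I i" "b \<in> I j" "b' \<in> I j" "c \<in> I k" "c' \<in> I k"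
      by (auto simp: C_def p)
    then have "\<bar>a - a'\<bar> + \<bar>b - b'\<bar> + \<bar>c - c'\<bar> \<le> 3 / N"
      using I[of a i a'] I[of b j b'] I[of c k c'] by simp
    then have "K * (\<bar>a - a'\<bar> + \<bar>b - b'\<bar> + \<bar>c - c'\<bar>) \<le> K * (3 / N)"
      using K by (intro mult_left_mono) auto
    then show ?thesis using f[of a b c a' b' c'] * by (simp add: mult.commute)
  qed
  have bC: "bounded (C p)" for p
  proof (cases "C p = {}")
    case False
    then obtain x where "x \<in> C p" by auto
    then show ?thesis using d unfolding bounded_def by blast
  qed simp
  have dC: "diameter (C p) \<le> 3 * K / N" for p
    using d K by (intro diameter_leI) auto
  let ?P = "{..<N} \<times> {..<N} \<times> {..<N}"
  have cover: "A \<subseteq> (\<Union>p\<in>?P. C p)"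
  proof
    fix x assume "x \<in> A"
    then obtain a b c where abc: "a \<in> {0..1}" "b \<in> {0..1}" "c \<in> {0..1}" "x = f a b c"
      using A by blast
    have "\<exists>i<N. a \<in> I i" "\<exists>i<N. b \<in> I i" "\<exists>i<N. c \<in> I i"
      using unit_interval_grid[OF N(1)] abc by (auto simp: I_def)
    then obtain i j k where "i < N" "j < N" "k < N" "a \<in> I i" "b \<in> I j" "c \<in> I k" by blast
    then have "x \<in> C (i, j, k)" "(i, j, k) \<in> ?P"
      using abc(4) by (auto simp: C_def)
    then show "x \<in> (\<Union>p\<in>?P. C p)" by blast
  qed
  have "hausdorff_pre 3 \<delta> A \<le> (\<Sum>p\<in>?P. diam_content 3 (C p))"
  proof (rule hausdorff_pre_le_finite_cover[OF _ \<delta> cover])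
    show "diameter (C p) \<le> \<delta>" for p using dC[of p] N\<delta> by linarith
  qed (auto simp: bC)
  also have "\<dots> \<le> (\<Sum>p\<in>?P. ennreal (unit_ball_vol 3 * (3 * K / N / 2) ^ 3))"
  proof (rule sum_mono)
    fix p
    show "diam_content 3 (C p) \<le> ennreal (unit_ball_vol 3 * (3 * K / N / 2) ^ 3)"
      using dC[of p] diameter_ge_0[OF bC[of p]]
      by (auto simp: diam_content_def intro!: ennreal_leI mult_left_mono power_mono)
  qed
  also have "\<dots> = ennreal (\<Sum>p\<in>?P. unit_ball_vol 3 * (3 * K / N / 2) ^ 3)"
    using K by (intro sum_ennreal) auto
  also have "(\<Sum>p\<in>?P. unit_ball_vol 3 * (3 * K / N / 2) ^ 3) = unit_ball_vol 3 * (3 * K / 2) ^ 3"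
    using N(1) by (simp add: card_cartesian_product power_divide power3_eq_cube)
  finally show "hausdorff_pre 3 \<delta> A \<le> ennreal (unit_ball_vol 3 * (3 * K / 2) ^ 3)" .
qed

lemma cmod_cis_diff_le: "cmod (cis a - cis b) \<le> \<bar>a - b\<bar>"
proof -
  have "cmod (cis a - cis b) = cmod (cis b * (cis (a - b) - 1))"
    by (simp add: algebra_simps cis_mult)
  also have "\<dots> = cmod (cis (a - b) - 1)"
    by (simp add: norm_mult)
  also have "\<dots> \<le> \<bar>a - b\<bar>"
    using dist_exp_i_1[of "a - b"] abs_sin_x_le_abs_x[of "(a - b) / 2"]
    by (simp add: cis_conv_exp)
  finally show ?thesis .
qed

text \<open>
  Polar coordinates \<open>(a, b, c) \<mapsto> (e\<^sup>i\<^sup>b cos a, e\<^sup>i\<^sup>c sin a)\<close>, with all angles rescaled by \<open>2\<pi>\<close>, map the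
  unit cube onto the sphere.
\<close>

lemma hausdorff_outer_sphere_S3_finite: "hausdorff_outer 3 sphere_S3 < top"
proof -
  define f :: "real \<Rightarrow> real \<Rightarrow> real \<Rightarrow> complex \<times> complex" where
    "f = (\<lambda>a b c. (cos (2 * pi * a) * cis (2 * pi * b), sin (2 * pi * a) * cis (2 * pi * c)))"
  have polar: "cmod (of_real s * cis b - of_real s' * cis b') \<le> \<bar>s - s'\<bar> + \<bar>b - b'\<bar>"
    if "\<bar>s\<bar> \<le> 1" for s s' b b' :: real
  proof -
    have "of_real s * cis b - of_real s' * cis b'
        = of_real s * (cis b - cis b') + of_real (s - s') * cis b'"
      by (simp add: algebra_simps)
    then have "cmod (of_real s * cis b - of_real s' * cis b')
        \<le> \<bar>s\<bar> * cmod (cis b - cis b') + \<bar>s - s'\<bar>"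
      by (metis norm_triangle_ineq norm_mult norm_of_real norm_cis mult_1_right)
    also have "\<bar>s\<bar> * cmod (cis b - cis b') \<le> 1 * \<bar>b - b'\<bar>"
      by (intro mult_mono that cmod_cis_diff_le) auto
    finally show ?thesis by simp
  qed
  have cos_lip: "\<bar>cos a - cos a'\<bar> \<le> \<bar>a - a'\<bar>" and sin_lip: "\<bar>sin a - sin a'\<bar> \<le> \<bar>a - a'\<bar>" for a a' :: real
    using abs_Re_le_cmod[of "cis a - cis a'"] abs_Im_le_cmod[of "cis a - cis a'"]
      cmod_cis_diff_le[of a a'] by auto
  have scale: "\<bar>2 * pi * a - 2 * pi * b\<bar> = 2 * pi * \<bar>a - b\<bar>" for a b
    by (simp add: abs_mult right_diff_distrib[symmetric])
  have "hausdorff_outer 3 sphere_S3 \<le> ennreal (unit_ball_vol 3 * (3 * (4 * pi) / 2) ^ 3)"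
  proof (rule hausdorff_outer_3_lipschitz_cube)
    fix a b c a' b' c'
    have "dist (f a b c) (f a' b' c') \<le> dist (fst (f a b c)) (fst (f a' b' c')) + dist (snd (f a b c)) (snd (f a' b' c'))"
      unfolding dist_prod_def by (rule sqrt_add_le_add_sqrt[THEN order_trans]) auto
    also have "\<dots> \<le> (2 * pi * \<bar>a - a'\<bar> + 2 * pi * \<bar>b - b'\<bar>) + (2 * pi * \<bar>a - a'\<bar> + 2 * pi * \<bar>c - c'\<bar>)"
    proof (rule add_mono)
      show "dist (fst (f a b c)) (fst (f a' b' c')) \<le> 2 * pi * \<bar>a - a'\<bar> + 2 * pi * \<bar>b - b'\<bar>"
        using polar[of "cos (2 * pi * a)" "2 * pi * b" "cos (2 * pi * a')" "2 * pi * b'"]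
          cos_lip[of "2 * pi * a" "2 * pi * a'"] unfolding scale by (simp add: f_def dist_norm)
      show "dist (snd (f a b c)) (snd (f a' b' c')) \<le> 2 * pi * \<bar>a - a'\<bar> + 2 * pi * \<bar>c - c'\<bar>"
        using polar[of "sin (2 * pi * a)" "2 * pi * c" "sin (2 * pi * a')" "2 * pi * c'"]
          sin_lip[of "2 * pi * a" "2 * pi * a'"] unfolding scale by (simp add: f_def dist_norm)
    qed
    also have "\<dots> \<le> 4 * pi * (\<bar>a - a'\<bar> + \<bar>b - b'\<bar> + \<bar>c - c'\<bar>)"
      by (simp add: algebra_simps)
    finally show "dist (f a b c) (f a' b' c') \<le> 4 * pi * (\<bar>a - a'\<bar> + \<bar>b - b'\<bar> + \<bar>c - c'\<bar>)" .
  next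
    fix x assume "x \<in> sphere_S3"
    then obtain z w where x: "x = (z, w)" "(cmod z)\<^sup>2 + (cmod w)\<^sup>2 = 1"
      by (auto simp: sphere_S3_def)
    then obtain t where t: "0 \<le> t" "t < 2 * pi" "cmod z = cos t" "cmod w = sin t"
      using sincos_total_2pi by metis
    have z: "z = cmod z * cis (Arg2pi z)" for z
      using Arg2pi[of z] by (simp add: is_Arg_def cis_conv_exp)
    have Arg: "Arg2pi z / (2 * pi) \<in> {0..1}" for z
      using Arg2pi_ge_0[of z] Arg2pi_lt_2pi[of z] by (auto simp: field_simps)
    have "x = f (t / (2 * pi)) (Arg2pi z / (2 * pi)) (Arg2pi w / (2 * pi))"
      using z[of z] z[of w] t by (simp add: f_def x)
    moreover have "t / (2 * pi) \<in> {0..1}" using t by (auto simp: field_simps)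
    ultimately show "\<exists>a\<in>{0..1}. \<exists>b\<in>{0..1}. \<exists>c\<in>{0..1}. x = f a b c"
      using Arg by blast
  qed simp
  then show ?thesis by (simp add: order.strict_trans1)
qed

text \<open>Forgetting one real coordinate does not increase distances and maps the sphere onto a ball.\<close>

lemma hausdorff_outer_sphere_S3_pos: "0 < hausdorff_outer 3 sphere_S3"
proof -
  define g :: "complex \<times> complex \<Rightarrow> complex \<times> real" where "g = (\<lambda>z. (fst z, Re (snd z)))"
  have D: "DIM(complex \<times> real) = 3" by simp
  have lip: "dist (g p) (g q) \<le> dist p q" for p q
  proof -
    have "(dist (Re (snd p)) (Re (snd q)))\<^sup>2 \<le> (dist (snd p) (snd q))\<^sup>2"
      using abs_Re_le_cmod[of "snd p - snd q"] by (intro power_mono) (auto simp: dist_norm)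
    then show ?thesis
      by (simp add: g_def dist_prod_def)
  qed
  \<comment> \<open>\<open>C\<close> projects into a ball of radius \<open>diameter C\<close>, twice the radius used in the content: \<open>2\<^sup>3 = 8\<close>.\<close>
  have "ennreal (1 / 8) * emeasure lborel (cball 0 1 :: (complex \<times> real) set) \<le> hausdorff_outer 3 sphere_S3"
  proof (rule emeasure_le_hausdorff_outer)
    show "cball 0 1 \<subseteq> g ` sphere_S3"
    proof
      fix x :: "complex \<times> real" assume x: "x \<in> cball 0 1"
      obtain w t where wt: "x = (w, t)" by (cases x)
      then have le: "(cmod w)\<^sup>2 + t\<^sup>2 \<le> 1" using x by (simp add: norm_Pair)
      define s where "s = sqrt (1 - (cmod w)\<^sup>2 - t\<^sup>2)"
      have "(w, Complex t s) \<in> sphere_S3"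
        using le by (simp add: sphere_S3_def s_def cmod_power2)
      then show "x \<in> g ` sphere_S3"
        by (intro image_eqI[of _ _ "(w, Complex t s)"]) (auto simp: g_def wt)
    qed
    fix C :: "(complex \<times> complex) set" assume C: "bounded C" "C \<noteq> {}"
    then obtain x where x: "x \<in> C" by blast
    have "g ` C \<subseteq> cball (g x) (diameter C)"
      using order_trans[OF lip diameter_bounded_bound[OF C(1) x]] by auto
    moreover have "ennreal (1 / 8) * emeasure lborel (cball (g x) (diameter C)) = diam_content 3 C"
      using diameter_ge_0[OF C(1)] C(2)
      by (simp add: emeasure_cball D diam_content_def ennreal_mult[symmetric] power_divide)
    ultimately show "\<exists>J\<in>sets lborel. g ` C \<subseteq> J \<and> ennreal (1 / 8) * emeasure lborel J \<le> diam_content 3 C"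
      by (intro bexI[of _ "cball (g x) (diameter C)"]) auto
  qed
  moreover have "0 < ennreal (1 / 8) * emeasure lborel (cball 0 1 :: (complex \<times> real) set)"
    by (simp add: emeasure_cball ennreal_mult[symmetric] unit_ball_vol_pos)
  ultimately show ?thesis by (rule order.strict_trans2[rotated])
qed

lemma emeasure_sphere_S3: "emeasure (hausdorff_measure 3) sphere_S3 = hausdorff_outer 3 sphere_S3"
  by (simp add: emeasure_hausdorff_measure)

lemma sets_surface_S3 [simp, measurable_cong]: "sets normalized_surface_S3 = sets borel"
  by (simp add: normalized_surface_S3_def)

lemma prob_space_surface_S3: "prob_space normalized_surface_S3"
  unfolding normalized_surface_S3_def
  using hausdorff_outer_sphere_S3_pos hausdorff_outer_sphere_S3_finite
  by (intro prob_space_uniform_measure) (auto simp: emeasure_sphere_S3)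

lemma AE_surface_S3: "AE z in normalized_surface_S3. z \<in> sphere_S3"
  unfolding normalized_surface_S3_def by (rule AE_uniform_measureI) auto

text \<open>Hausdorff measure depends on distances only, so an isometry of the sphere preserves it.\<close>

lemma distr_surface_S3_isometry:
  assumes f: "\<And>x y. dist (f x) (f y) = dist x y" and g: "\<And>x y. dist (g x) (g y) = dist x y"
    and inv: "\<And>x. g (f x) = x" "\<And>x. f (g x) = x"
    and S: "\<And>x. f x \<in> sphere_S3 \<longleftrightarrow> x \<in> sphere_S3"
  shows "distr normalized_surface_S3 borel f = normalized_surface_S3"
proof (rule measure_eqI)
  have "continuous_on UNIV f"
    unfolding continuous_on_iff by (auto simp: f)
  then have [measurable]: "f \<in> borel_measurable borel"
    by (rule borel_measurable_continuous_onI)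
  fix A assume "A \<in> sets (distr normalized_surface_S3 borel f)"
  then have [measurable]: "A \<in> sets borel" by simp
  have [measurable]: "f -` A \<in> sets borel"
    using measurable_sets[of f borel borel A] by simp
  define B where "B = sphere_S3 \<inter> A"
  have pre: "sphere_S3 \<inter> f -` A = f -` B"
    by (simp add: B_def S set_eq_iff)
  have "f ` (f -` B) = B"
    using inv(2) by (metis surj_def surj_image_vimage_eq)
  moreover have "g ` B = f -` B"
  proof (rule antisym)
    show "g ` B \<subseteq> f -` B" by (auto simp: inv)
    show "f -` B \<subseteq> g ` B" by (metis inv(1) image_eqI subsetI vimageD)
  qed
  moreover have "hausdorff_outer 3 (f ` (f -` B)) \<le> hausdorff_outer 3 (f -` B)"
    by (rule hausdorff_outer_nonexpansive_image) (simp add: f)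
  moreover have "hausdorff_outer 3 (g ` B) \<le> hausdorff_outer 3 B"
    by (rule hausdorff_outer_nonexpansive_image) (simp add: g)
  ultimately have "hausdorff_outer 3 (sphere_S3 \<inter> f -` A) = hausdorff_outer 3 (sphere_S3 \<inter> A)"
    unfolding pre by (simp add: B_def)
  then show "emeasure (distr normalized_surface_S3 borel f) A = emeasure normalized_surface_S3 A"
    by (simp add: emeasure_distr normalized_surface_S3_def emeasure_uniform_measure
        emeasure_hausdorff_measure)
qed simp

lemma cmod_rotation:
  fixes x y :: complex and u v :: real
  assumes "u\<^sup>2 + v\<^sup>2 = 1"
  shows "(cmod (u * x + v * y))\<^sup>2 + (cmod (u * y - v * x))\<^sup>2 = (cmod x)\<^sup>2 + (cmod y)\<^sup>2"
proof -
  have "(cmod (u * x + v * y))\<^sup>2 + (cmod (u * y - v * x))\<^sup>2 = (u\<^sup>2 + v\<^sup>2) * ((cmod x)\<^sup>2 + (cmod y)\<^sup>2)"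
    unfolding cmod_power2 by (simp add: power2_eq_square algebra_simps)
  then show ?thesis using assms by simp
qed

lemma distr_surface_S3_rotation:
  fixes u v :: real
  assumes uv: "u\<^sup>2 + v\<^sup>2 = 1"
  shows "distr normalized_surface_S3 borel (\<lambda>z. (u * fst z + v * snd z, u * snd z - v * fst z))
    = normalized_surface_S3"
proof -
  define f where "f = (\<lambda>(u::real) (v::real) (z :: complex \<times> complex). (u * fst z + v * snd z, u * snd z - v * fst z))"
  have d: "dist (f u v x) (f u v y) = dist x y" if "u\<^sup>2 + v\<^sup>2 = 1" for x y u v
    using cmod_rotation[OF that, of "fst x - fst y" "snd x - snd y"]
    by (simp add: f_def dist_prod_def dist_norm algebra_simps)
  have inv: "f u (- v) (f u v z) = z" if "u\<^sup>2 + v\<^sup>2 = 1" for u v z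
  proof -
    have "complex_of_real u * u + complex_of_real v * v = of_real (u\<^sup>2 + v\<^sup>2)"
      by (simp add: power2_eq_square)
    also have "\<dots> = 1" using that by simp
    finally have *: "complex_of_real u * u + complex_of_real v * v = 1" .
    have "f u (- v) (f u v z) = ((complex_of_real u * u + complex_of_real v * v) * fst z, (complex_of_real u * u + complex_of_real v * v) * snd z)"
      by (simp add: f_def algebra_simps)
    then show ?thesis by (simp add: *)
  qed
  have "distr normalized_surface_S3 borel (f u v) = normalized_surface_S3"
  proof (rule distr_surface_S3_isometry[of _ "f u (- v)"])
    show "f u v x \<in> sphere_S3 \<longleftrightarrow> x \<in> sphere_S3" for x
      using cmod_rotation[OF uv, of "fst x" "snd x"] by (auto simp: f_def sphere_S3_def split: prod.splits)
  qed (use uv d[of u v] d[of u "- v"] inv[of u v] inv[of u "- v"] in auto)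
  then show ?thesis by (simp add: f_def)
qed

lemma distr_surface_S3_torus:
  assumes "cmod c = 1" "cmod c' = 1"
  shows "distr normalized_surface_S3 borel (\<lambda>z. (c * fst z, c' * snd z)) = normalized_surface_S3"
proof -
  have ne: "c \<noteq> 0" "c' \<noteq> 0" using assms by auto
  show ?thesis
  proof (rule distr_surface_S3_isometry[of _ "\<lambda>z. (inverse c * fst z, inverse c' * snd z)"])
    have d: "dist (a * x) (a * y) = dist x y" if "cmod a = 1" for a x y :: complex
      using that by (simp add: dist_norm norm_mult flip: right_diff_distrib)
    show "dist (c * fst x, c' * snd x) (c * fst y, c' * snd y) = dist x y" for x y
      using assms by (simp add: dist_prod_def d)
    show "dist (inverse c * fst x, inverse c' * snd x) (inverse c * fst y, inverse c' * snd y) = dist x y" for x y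
      using assms by (simp add: dist_prod_def d norm_inverse)
    show "(c * fst x, c' * snd x) \<in> sphere_S3 \<longleftrightarrow> x \<in> sphere_S3" for x
      using assms by (auto simp: sphere_S3_def norm_mult split: prod.splits)
  qed (use ne in \<open>auto simp: prod_eq_iff mult.assoc[symmetric]\<close>)
qed

section \<open>Moments of the surface measure\<close>

interpretation S3: prob_space normalized_surface_S3
  by (rule prob_space_surface_S3)

lemma compact_sphere_S3: "compact sphere_S3"
proof -
  have "norm z = 1" if "z \<in> sphere_S3" for z
    using that by (auto simp: sphere_S3_def norm_Pair)
  then have "bounded sphere_S3"
    by (intro boundedI[of _ 1]) auto
  then show ?thesis
    using closed_sphere_S3 by (simp add: compact_eq_bounded_closed)
qed

lemma integrable_surface_S3:
  fixes F :: "complex \<times> complex \<Rightarrow> 'b::{banach, second_countable_topology}"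
  assumes F: "continuous_on UNIV F"
  shows "integrable normalized_surface_S3 F"
proof -
  have "bounded (F ` sphere_S3)"
    by (intro compact_imp_bounded compact_continuous_image compact_sphere_S3
        continuous_on_subset[OF F]) auto
  then obtain B where "\<And>z. z \<in> sphere_S3 \<Longrightarrow> norm (F z) \<le> B"
    unfolding bounded_iff by auto
  then have "AE z in normalized_surface_S3. norm (F z) \<le> B"
    using AE_surface_S3 by auto
  then show ?thesis
    using borel_measurable_continuous_onI[OF F] by (intro S3.integrable_const_bound) auto
qed

lemma integral_surface_S3_invariant:
  fixes F :: "complex \<times> complex \<Rightarrow> 'b::{banach, second_countable_topology}"
  assumes "distr normalized_surface_S3 borel f = normalized_surface_S3"
    and F: "continuous_on UNIV F" and f: "continuous_on UNIV f"
  shows "(\<integral>z. F (f z) \<partial>normalized_surface_S3) = (\<integral>z. F z \<partial>normalized_surface_S3)"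
proof -
  have "(\<integral>z. F z \<partial>normalized_surface_S3) = (\<integral>z. F z \<partial>distr normalized_surface_S3 borel f)"
    by (simp add: assms(1))
  also have "\<dots> = (\<integral>z. F (f z) \<partial>normalized_surface_S3)"
    using borel_measurable_continuous_onI[OF F] borel_measurable_continuous_onI[OF f]
    by (intro integral_distr) auto
  finally show ?thesis ..
qed

definition holo_monomial :: "nat \<Rightarrow> nat \<Rightarrow> complex \<times> complex \<Rightarrow> complex" where
  "holo_monomial a b z = fst z ^ a * snd z ^ b"

lemma continuous_on_holo_monomial [continuous_intros]: "continuous_on A (holo_monomial a b)"
  unfolding holo_monomial_def[abs_def] by (intro continuous_intros)

lemma continuous_on_holo_monomial_cnj: "continuous_on UNIV (\<lambda>z. holo_monomial a b z * cnj (holo_monomial a' b' z))"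
  by (intro continuous_intros)

text \<open>
  The torus \<open>(z\<^sub>1, z\<^sub>2) \<mapsto> (c z\<^sub>1, d z\<^sub>2)\<close> preserves the measure but multiplies different monomials by
  different characters; a torus element at which the two differ by the factor \<open>-1\<close> forces the
  integral to vanish.
\<close>

lemma integral_holo_monomial_orthogonal:
  assumes "(a, b) \<noteq> (a', b')"
  shows "(\<integral>z. holo_monomial a b z * cnj (holo_monomial a' b' z) \<partial>normalized_surface_S3) = 0" (is "?I = 0")
proof -
  have *: "?I = c ^ a * cnj c ^ a' * (d ^ b * cnj d ^ b') * ?I" if "cmod c = 1" "cmod d = 1" for c d
  proof -
    have "?I = (\<integral>z. holo_monomial a b (c * fst z, d * snd z) * cnj (holo_monomial a' b' (c * fst z, d * snd z))
        \<partial>normalized_surface_S3)"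
      by (intro integral_surface_S3_invariant[symmetric] distr_surface_S3_torus that
          continuous_on_holo_monomial_cnj continuous_intros)
    also have "\<dots> = (\<integral>z. c ^ a * cnj c ^ a' * (d ^ b * cnj d ^ b') *
        (holo_monomial a b z * cnj (holo_monomial a' b' z)) \<partial>normalized_surface_S3)"
      by (simp add: holo_monomial_def power_mult_distrib mult_ac)
    finally show ?thesis by simp
  qed
  have ex: "\<exists>c. cmod c = 1 \<and> c ^ k * cnj c ^ l = -1" if "k \<noteq> l" for k l :: nat
  proof -
    let ?t = "pi / (real k - real l)"
    have "cis ?t ^ k * cnj (cis ?t) ^ l = cis (real k * ?t - real l * ?t)"
      by (simp only: cis_cnj Complex.DeMoivre cis_mult mult_minus_right diff_conv_add_uminus)
    also have "real k * ?t - real l * ?t = pi"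
      using that by (simp only: left_diff_distrib[symmetric]) simp
    finally show ?thesis
      by (intro exI[of _ "cis ?t"]) simp
  qed
  show ?thesis
  proof (cases "a = a'")
    case False
    then obtain c where "cmod c = 1" "c ^ a * cnj c ^ a' = -1" using ex by blast
    then show ?thesis using *[of c 1] by simp
  next
    case True
    then have "b \<noteq> b'" using assms by simp
    then obtain d where "cmod d = 1" "d ^ b * cnj d ^ b' = -1" using ex by blast
    then show ?thesis using *[of 1 d] by simp
  qed
qed

definition surface_moment :: "nat \<Rightarrow> nat \<Rightarrow> real" where
  "surface_moment a b =
     (\<integral>z. cmod (fst z) ^ (2 * a) * cmod (snd z) ^ (2 * b) \<partial>normalized_surface_S3)"

lemma of_real_cmod_power: "complex_of_real (cmod w ^ (2 * n)) = w ^ n * cnj w ^ n"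
  by (simp only: power_mult of_real_power[of "(cmod w)\<^sup>2"] complex_norm_square power_mult_distrib)

lemma integral_holo_monomial:
  "(\<integral>z. holo_monomial a b z * cnj (holo_monomial a' b' z) \<partial>normalized_surface_S3)
    = (if (a, b) = (a', b') then of_real (surface_moment a b) else 0)"
proof (cases "(a, b) = (a', b')")
  case True
  have "holo_monomial a b z * cnj (holo_monomial a b z)
      = of_real (cmod (fst z) ^ (2 * a) * cmod (snd z) ^ (2 * b))" for z
    unfolding of_real_mult of_real_cmod_power by (simp add: holo_monomial_def mult_ac)
  then have "(\<integral>z. holo_monomial a b z * cnj (holo_monomial a b z) \<partial>normalized_surface_S3) = of_real (surface_moment a b)"
    by (simp only: surface_moment_def integral_complex_of_real)
  then show ?thesis using True by simp
qed (use integral_holo_monomial_orthogonal in auto)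

text \<open>
  A rotation turns \<open>|z\<^sub>1|\<^sup>2\<^sup>n\<close> into \<open>|u z\<^sub>1 + v z\<^sub>2|\<^sup>2\<^sup>n\<close>; in its binomial expansion only the squares of
  the monomials survive integration.
\<close>

lemma surface_moment_rotation:
  assumes uv: "u\<^sup>2 + v\<^sup>2 = 1"
  shows "(\<Sum>k\<le>n. (real (n choose k))\<^sup>2 * (u\<^sup>2) ^ k * (v\<^sup>2) ^ (n - k) * surface_moment k (n - k))
    = surface_moment n 0"
proof -
  define w where "w = (\<lambda>k. complex_of_real (real (n choose k) * u ^ k * v ^ (n - k)))"
  have expand: "(u * fst z + v * snd z) ^ n = (\<Sum>k\<le>n. w k * holo_monomial k (n - k) z)"
    for z :: "complex \<times> complex"
    by (simp add: binomial_ring w_def holo_monomial_def power_mult_distrib mult_ac)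
  have "complex_of_real (surface_moment n 0)
      = (\<integral>z. of_real (cmod (fst z) ^ (2 * n)) \<partial>normalized_surface_S3)"
    unfolding surface_moment_def by (subst integral_complex_of_real) simp
  also have "\<dots> = (\<integral>z. of_real (cmod (fst (u * fst z + v * snd z, u * snd z - v * fst z)) ^ (2 * n))
      \<partial>normalized_surface_S3)"
    by (intro integral_surface_S3_invariant[symmetric] distr_surface_S3_rotation uv
        continuous_intros)
  also have "\<dots> = (\<integral>z. (\<Sum>k\<le>n. w k * holo_monomial k (n - k) z) * cnj (\<Sum>k\<le>n. w k * holo_monomial k (n - k) z)
      \<partial>normalized_surface_S3)"
    unfolding of_real_cmod_power fst_conv complex_cnj_power[symmetric] expand ..
  also have "\<dots> = (\<integral>z. (\<Sum>k\<le>n. \<Sum>l\<le>n. w k * cnj (w l) *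
      (holo_monomial k (n - k) z * cnj (holo_monomial l (n - l) z))) \<partial>normalized_surface_S3)"
    by (simp add: sum_product mult_ac)
  also have "\<dots> = (\<Sum>k\<le>n. \<Sum>l\<le>n. w k * cnj (w l) *
      (\<integral>z. holo_monomial k (n - k) z * cnj (holo_monomial l (n - l) z) \<partial>normalized_surface_S3))"
    by (subst Bochner_Integration.integral_sum, (intro integrable_surface_S3 continuous_intros)[1])+ 
      (simp add: integrable_surface_S3 continuous_on_holo_monomial_cnj)
  also have "\<dots> = (\<Sum>k\<le>n. \<Sum>l\<le>n. if l = k then w k * cnj (w k) * of_real (surface_moment k (n - k)) else 0)"
    unfolding integral_holo_monomial by (intro sum.cong) auto
  also have "\<dots> = (\<Sum>k\<le>n. w k * cnj (w k) * of_real (surface_moment k (n - k)))"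
    by (simp add: sum.delta')
  also have "\<dots> = of_real (\<Sum>k\<le>n. (real (n choose k))\<^sup>2 * (u\<^sup>2) ^ k * (v\<^sup>2) ^ (n - k) * surface_moment k (n - k))"
    by (simp add: w_def power2_eq_square power_mult_distrib mult_ac)
  finally show ?thesis by (simp only: of_real_eq_iff)
qed

text \<open>Since \<open>u\<^sup>2 / v\<^sup>2\<close> takes every nonnegative value, coefficients may be compared.\<close>

lemma surface_moment_binomial:
  assumes "k \<le> n"
  shows "real (n choose k) * surface_moment k (n - k) = surface_moment n 0"
proof -
  define c where "c = (\<lambda>k. real (n choose k) * (real (n choose k) * surface_moment k (n - k) - surface_moment n 0))"
  have "(\<Sum>k\<le>n. c k * x ^ k) = 0" if x: "0 \<le> x" for x
  proof -
    \<comment> \<open>\<open>u\<^sup>2 = x / s\<close> and \<open>v\<^sup>2 = 1 / s\<close> have the quotient \<open>x\<close> and the sum 1.\<close>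
    define s where "s = 1 + x"
    have s: "0 < s" using x by (simp add: s_def)
    have "(sqrt (x / s))\<^sup>2 + (sqrt (1 / s))\<^sup>2 = 1"
      using x s by (simp add: s_def add_divide_distrib[symmetric])
    from surface_moment_rotation[OF this, of n]
    have "surface_moment n 0 = (\<Sum>k\<le>n. (real (n choose k))\<^sup>2 * (x / s) ^ k * (1 / s) ^ (n - k) * surface_moment k (n - k))"
      using x s by simp
    also have "\<dots> = (\<Sum>k\<le>n. (real (n choose k))\<^sup>2 * x ^ k * surface_moment k (n - k) / s ^ n)"
      using s by (intro sum.cong) (auto simp: power_divide simp flip: power_add)
    finally have "(\<Sum>k\<le>n. (real (n choose k))\<^sup>2 * x ^ k * surface_moment k (n - k)) = surface_moment n 0 * s ^ n"
      using s by (simp add: sum_divide_distrib[symmetric] field_simps)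
    moreover have "s ^ n = (\<Sum>k\<le>n. real (n choose k) * x ^ k)"
      using binomial_ring[of x 1 n] by (simp add: s_def add.commute)
    ultimately show ?thesis
      by (simp add: c_def algebra_simps sum_subtractf sum_distrib_left power2_eq_square)
  qed
  then have "{0..} \<subseteq> {x. (\<Sum>k\<le>n. c k * x ^ k) = 0}" by auto
  moreover have "infinite {0::real..}" by (simp add: infinite_Ici)
  ultimately have "infinite {x. (\<Sum>k\<le>n. c k * x ^ k) = 0}"
    using finite_subset by blast
  then have "c k = 0" using polyfun_finite_roots[of c n] assms by auto
  then show ?thesis using assms by (simp add: c_def)
qed

text \<open>
  On the sphere \<open>1 = (|z\<^sub>1|\<^sup>2 + |z\<^sub>2|\<^sup>2)\<^sup>n\<close>. Its binomial expansion has \<open>n + 1\<close> terms, which all have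
  the same integral.
\<close>

lemma surface_moment_eq: "surface_moment a b = fact a * fact b / fact (a + b + 1)"
proof -
  define n where "n = a + b"
  have "1 = (\<integral>z. (1::real) \<partial>normalized_surface_S3)"
    by (simp add: S3.prob_space)
  also have "\<dots> = (\<integral>z. (\<Sum>k\<le>n. real (n choose k) * (cmod (fst z) ^ (2 * k) * cmod (snd z) ^ (2 * (n - k))))
      \<partial>normalized_surface_S3)"
  proof (rule integral_cong_AE)
    show "(\<lambda>z. \<Sum>k\<le>n. real (n choose k) * (cmod (fst z) ^ (2 * k) * cmod (snd z) ^ (2 * (n - k))))
        \<in> borel_measurable normalized_surface_S3"
      by (intro borel_measurable_integrable integrable_surface_S3 continuous_intros)
    have "1 = (\<Sum>k\<le>n. real (n choose k) * (cmod (fst z) ^ (2 * k) * cmod (snd z) ^ (2 * (n - k))))"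
      if "z \<in> sphere_S3" for z
    proof -
      have "1 = ((cmod (fst z))\<^sup>2 + (cmod (snd z))\<^sup>2) ^ n"
        using that by (auto simp: sphere_S3_def)
      also have "\<dots> = (\<Sum>k\<le>n. real (n choose k) * (cmod (fst z) ^ (2 * k) * cmod (snd z) ^ (2 * (n - k))))"
        by (simp add: binomial_ring mult.assoc flip: power_mult)
      finally show ?thesis .
    qed
    then show "AE z in normalized_surface_S3. 1 = (\<Sum>k\<le>n. real (n choose k) *
        (cmod (fst z) ^ (2 * k) * cmod (snd z) ^ (2 * (n - k))))"
      using AE_surface_S3 by auto
  qed simp
  also have "\<dots> = (\<Sum>k\<le>n. real (n choose k) * surface_moment k (n - k))"
    unfolding surface_moment_def
    by (subst Bochner_Integration.integral_sum)
      (auto intro!: integrable_surface_S3 continuous_intros)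
  also have "\<dots> = (real n + 1) * surface_moment n 0"
    by (simp add: surface_moment_binomial)
  finally have "surface_moment n 0 = 1 / (real n + 1)" by (simp add: field_simps)
  then have "real (n choose a) * surface_moment a b = 1 / (real n + 1)"
    using surface_moment_binomial[of a n] by (simp add: n_def)
  moreover have "real (n choose a) = fact n / (fact a * fact b)"
    by (simp add: n_def binomial_fact)
  ultimately have "surface_moment a b * fact n * (real n + 1) = fact a * fact b"
    by (simp add: field_simps)
  moreover have "fact (a + b + 1) = fact n * (real n + 1)"
    by (simp add: n_def algebra_simps)
  ultimately show ?thesis
    by (simp add: eq_divide_eq mult.assoc)
qed

section \<open>Square-integrable functions\<close>

lemma LsqD [dest]:
  assumes "f \<in> Lsq M"
  shows "f \<in> borel_measurable M" "integrable M (\<lambda>x. (cmod (f x))\<^sup>2)"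
  using assms by (auto simp: Lsq_def)

lemma LsqI:
  assumes "f \<in> borel_measurable M" "integrable M g" "\<And>x. (cmod (f x))\<^sup>2 \<le> g x"
  shows "f \<in> Lsq M"
  using assms unfolding Lsq_def
  by (auto intro!: Bochner_Integration.integrable_bound[OF assms(2)] AE_I2 order_trans[OF assms(3) abs_ge_self])

lemma integrable_Lsq_inner:
  assumes "f \<in> Lsq M" "g \<in> Lsq M"
  shows "integrable M (\<lambda>x. f x * cnj (g x))"
proof (rule Bochner_Integration.integrable_bound)
  note [measurable] = LsqD(1)[OF assms(1)] LsqD(1)[OF assms(2)]
  show "integrable M (\<lambda>x. (cmod (f x))\<^sup>2 + (cmod (g x))\<^sup>2)"
    using LsqD(2)[OF assms(1)] LsqD(2)[OF assms(2)] by (rule Bochner_Integration.integrable_add)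
  show "(\<lambda>x. f x * cnj (g x)) \<in> borel_measurable M"
    by (intro borel_measurable_times borel_measurable_continuous_on[OF continuous_on_cnj[OF continuous_on_id]]) auto
  have "cmod (f x * cnj (g x)) \<le> (cmod (f x))\<^sup>2 + (cmod (g x))\<^sup>2" for x
    using sum_squares_bound[of "cmod (f x)" "cmod (g x)"] zero_le_power2[of "cmod (f x)"] 
      mult_nonneg_nonneg[of "cmod (f x)" "cmod (g x)"] norm_ge_zero[of "f x"] norm_ge_zero[of "g x"]
    unfolding norm_mult complex_mod_cnj by linarith
  then show "AE x in M. cmod (f x * cnj (g x)) \<le> norm ((cmod (f x))\<^sup>2 + (cmod (g x))\<^sup>2)"
    by (intro AE_I2) (auto intro: order_trans)
qed

lemma Lsq_cmult:
  assumes "f \<in> Lsq M"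
  shows "(\<lambda>x. a * f x) \<in> Lsq M"
  using assms by (auto simp: Lsq_def norm_mult power_mult_distrib)

lemma Lsq_add:
  assumes "f \<in> Lsq M" "g \<in> Lsq M"
  shows "(\<lambda>x. f x + g x) \<in> Lsq M"
proof (rule LsqI)
  note [measurable] = LsqD(1)[OF assms(1)] LsqD(1)[OF assms(2)]
  show "(\<lambda>x. f x + g x) \<in> borel_measurable M" by measurable
  show "integrable M (\<lambda>x. 2 * (cmod (f x))\<^sup>2 + 2 * (cmod (g x))\<^sup>2)"
    using LsqD(2)[OF assms(1)] LsqD(2)[OF assms(2)] by auto
  fix x
  have "(cmod (f x + g x))\<^sup>2 \<le> (cmod (f x) + cmod (g x))\<^sup>2"
    by (intro power_mono norm_triangle_ineq) auto
  also have "\<dots> \<le> 2 * (cmod (f x))\<^sup>2 + 2 * (cmod (g x))\<^sup>2"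
    using sum_squares_bound[of "cmod (f x)" "cmod (g x)"] by (simp add: power2_sum)
  finally show "(cmod (f x + g x))\<^sup>2 \<le> 2 * (cmod (f x))\<^sup>2 + 2 * (cmod (g x))\<^sup>2" .
qed

lemma Lsq_diff:
  assumes "f \<in> Lsq M" "g \<in> Lsq M"
  shows "(\<lambda>x. f x - g x) \<in> Lsq M"
  using Lsq_add[OF assms(1) Lsq_cmult[OF assms(2), of "-1"]] by simp

lemma Lsq_sum:
  assumes "\<And>k. k \<in> I \<Longrightarrow> f k \<in> Lsq M"
  shows "(\<lambda>x. \<Sum>k\<in>I. f k x) \<in> Lsq M"
  using assms
proof (induction I rule: infinite_finite_induct)
  case (insert k I)
  then show ?case using Lsq_add[of "f k" M "\<lambda>x. \<Sum>k\<in>I. f k x"] by simp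
qed (simp_all add: Lsq_def)

lemma Lsq_norm_nonneg [simp]: "0 \<le> Lsq_norm M f"
  by (simp add: Lsq_norm_def)

lemma Lsq_norm_power2: "(Lsq_norm M f)\<^sup>2 = (\<integral>x. (cmod (f x))\<^sup>2 \<partial>M)"
  by (simp add: Lsq_norm_def)

lemma Lsq_norm_cmult: "Lsq_norm M (\<lambda>x. a * f x) = cmod a * Lsq_norm M f"
  by (simp add: Lsq_norm_def norm_mult power_mult_distrib real_sqrt_mult)

lemma Lsq_norm_minus_commute: "Lsq_norm M (\<lambda>x. f x - g x) = Lsq_norm M (\<lambda>x. g x - f x)"
  by (simp add: Lsq_norm_def norm_minus_commute)

lemma Lsq_norm_mono:
  assumes "f \<in> borel_measurable M" "g \<in> Lsq M" "AE x in M. cmod (f x) \<le> cmod (g x)"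
  shows "Lsq_norm M f \<le> Lsq_norm M g"
proof -
  have "(\<integral>x. (cmod (f x))\<^sup>2 \<partial>M) \<le> (\<integral>x. (cmod (g x))\<^sup>2 \<partial>M)"
    using assms(3) LsqD(2)[OF assms(2)] by (intro integral_mono_AE') (auto intro: power_mono)
  then show ?thesis by (simp add: Lsq_norm_def)
qed

lemma Lsq_norm_eq_0_AE:
  assumes "f \<in> Lsq M" "Lsq_norm M f = 0"
  shows "AE x in M. f x = 0"
proof -
  have "(\<integral>x. (cmod (f x))\<^sup>2 \<partial>M) = 0"
    using assms(2) by (simp add: Lsq_norm_def)
  then have "AE x in M. (cmod (f x))\<^sup>2 = 0"
    using LsqD(2)[OF assms(1)] by (subst (asm) integral_nonneg_eq_0_iff_AE) auto
  then show ?thesis by simp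
qed

lemma Lsq_inner_self: "Lsq_inner M f f = of_real ((Lsq_norm M f)\<^sup>2)"
  unfolding Lsq_inner_def Lsq_norm_power2
  by (simp only: complex_norm_square[symmetric] integral_complex_of_real)

lemma Lsq_inner_cnj:
  assumes "f \<in> Lsq M" "g \<in> Lsq M"
  shows "cnj (Lsq_inner M f g) = Lsq_inner M g f"
  using integral_bounded_linear[OF bounded_linear_cnj integrable_Lsq_inner[OF assms]]
  by (simp add: Lsq_inner_def mult.commute)

lemma Lsq_inner_cmult_left: "Lsq_inner M (\<lambda>x. a * f x) g = a * Lsq_inner M f g"
  by (simp add: Lsq_inner_def mult.assoc)

lemma Lsq_inner_cmult_right: "Lsq_inner M f (\<lambda>x. a * g x) = cnj a * Lsq_inner M f g"
  by (simp add: Lsq_inner_def mult.left_commute)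

lemma Lsq_inner_diff_left:
  assumes "f \<in> Lsq M" "g \<in> Lsq M" "h \<in> Lsq M"
  shows "Lsq_inner M (\<lambda>x. f x - g x) h = Lsq_inner M f h - Lsq_inner M g h"
  unfolding Lsq_inner_def left_diff_distrib
  by (intro Bochner_Integration.integral_diff integrable_Lsq_inner assms)

lemma Lsq_inner_diff_right:
  assumes "f \<in> Lsq M" "g \<in> Lsq M" "h \<in> Lsq M"
  shows "Lsq_inner M h (\<lambda>x. f x - g x) = Lsq_inner M h f - Lsq_inner M h g"
  using Lsq_inner_diff_left[OF assms] assms
  by (simp flip: Lsq_inner_cnj[of _ _ h] add: Lsq_diff)

lemma Lsq_inner_sum_left:
  assumes "\<And>k. k \<in> I \<Longrightarrow> f k \<in> Lsq M" "h \<in> Lsq M"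
  shows "Lsq_inner M (\<lambda>x. \<Sum>k\<in>I. f k x) h = (\<Sum>k\<in>I. Lsq_inner M (f k) h)"
  unfolding Lsq_inner_def sum_distrib_right
  by (intro Bochner_Integration.integral_sum integrable_Lsq_inner assms)

lemma Lsq_inner_sum_right:
  assumes "\<And>k. k \<in> I \<Longrightarrow> f k \<in> Lsq M" "h \<in> Lsq M"
  shows "Lsq_inner M h (\<lambda>x. \<Sum>k\<in>I. f k x) = (\<Sum>k\<in>I. Lsq_inner M h (f k))"
proof -
  have "Lsq_inner M h (\<lambda>x. \<Sum>k\<in>I. f k x) = cnj (Lsq_inner M (\<lambda>x. \<Sum>k\<in>I. f k x) h)"
    using assms by (intro Lsq_inner_cnj[symmetric] Lsq_sum) auto
  also have "\<dots> = (\<Sum>k\<in>I. cnj (Lsq_inner M (f k) h))"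
    using assms by (simp add: Lsq_inner_sum_left)
  also have "\<dots> = (\<Sum>k\<in>I. Lsq_inner M h (f k))"
    using assms by (intro sum.cong Lsq_inner_cnj) auto
  finally show ?thesis .
qed

lemma Lsq_norm_add_power2:
  assumes "f \<in> Lsq M" "g \<in> Lsq M"
  shows "(Lsq_norm M (\<lambda>x. f x + g x))\<^sup>2 = (Lsq_norm M f)\<^sup>2 + 2 * Re (Lsq_inner M f g) + (Lsq_norm M g)\<^sup>2"
proof -
  have *: "(cmod (a + b))\<^sup>2 = (cmod a)\<^sup>2 + 2 * Re (a * cnj b) + (cmod b)\<^sup>2" for a b
    unfolding cmod_power2 by (simp add: power2_eq_square algebra_simps)
  have int: "integrable M (\<lambda>x. Re (f x * cnj (g x)))"
    by (intro integrable_Re integrable_Lsq_inner assms)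
  show ?thesis
    unfolding Lsq_norm_power2 * Lsq_inner_def integral_Re[OF integrable_Lsq_inner[OF assms], symmetric]
    using int LsqD(2)[OF assms(1)] LsqD(2)[OF assms(2)]
    by (simp del: times_complex.simps)
qed

text \<open>
  Integrate \<open>(b |f| - a |g|)\<^sup>2 \<ge> 0\<close> with \<open>a\<close> and \<open>b\<close> the norms of \<open>f\<close> and \<open>g\<close>.
\<close>

lemma Lsq_Cauchy_Schwarz:
  assumes f: "f \<in> Lsq M" and g: "g \<in> Lsq M"
  shows "cmod (Lsq_inner M f g) \<le> Lsq_norm M f * Lsq_norm M g"
proof (cases "Lsq_norm M f = 0 \<or> Lsq_norm M g = 0")
  case True
  have "AE x in M. f x * cnj (g x) = 0"
    using True Lsq_norm_eq_0_AE[OF f] Lsq_norm_eq_0_AE[OF g] by auto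
  then have "Lsq_inner M f g = 0"
    unfolding Lsq_inner_def by (rule integral_eq_zero_AE)
  then show ?thesis by simp
next
  case False
  define a b where "a = Lsq_norm M f" and "b = Lsq_norm M g"
  have ab: "0 < a" "0 < b"
    using False by (auto simp: a_def b_def less_le)
  have int: "integrable M (\<lambda>x. cmod (f x) * cmod (g x))"
    using integrable_norm[OF integrable_Lsq_inner[OF f g]] by (simp add: norm_mult)
  have "0 \<le> (\<integral>x. (b * cmod (f x) - a * cmod (g x))\<^sup>2 \<partial>M)" by simp
  also have "\<dots> = (\<integral>x. b\<^sup>2 * (cmod (f x))\<^sup>2 + a\<^sup>2 * (cmod (g x))\<^sup>2 - (2 * a * b) * (cmod (f x) * cmod (g x)) \<partial>M)"
    by (simp add: power2_eq_square algebra_simps)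
  also have "\<dots> = b\<^sup>2 * a\<^sup>2 + a\<^sup>2 * b\<^sup>2 - (2 * a * b) * (\<integral>x. cmod (f x) * cmod (g x) \<partial>M)"
    using int LsqD(2)[OF f] LsqD(2)[OF g]
    by (simp add: a_def b_def Lsq_norm_power2)
  finally have "(2 * a * b) * (\<integral>x. cmod (f x) * cmod (g x) \<partial>M) \<le> (2 * a * b) * (a * b)"
    by (simp add: power2_eq_square algebra_simps)
  then have "(\<integral>x. cmod (f x) * cmod (g x) \<partial>M) \<le> a * b"
    using ab by simp
  moreover have "cmod (Lsq_inner M f g) \<le> (\<integral>x. cmod (f x) * cmod (g x) \<partial>M)"
    unfolding Lsq_inner_def using integral_norm_bound[of M "\<lambda>x. f x * cnj (g x)"]
    by (simp add: norm_mult)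
  ultimately show ?thesis by (simp add: a_def b_def)
qed

lemma Lsq_norm_triangle:
  assumes "f \<in> Lsq M" "g \<in> Lsq M"
  shows "Lsq_norm M (\<lambda>x. f x + g x) \<le> Lsq_norm M f + Lsq_norm M g"
proof (rule power2_le_imp_le)
  have "Re (Lsq_inner M f g) \<le> Lsq_norm M f * Lsq_norm M g"
    using Lsq_Cauchy_Schwarz[OF assms] complex_Re_le_cmod order_trans by blast
  then show "(Lsq_norm M (\<lambda>x. f x + g x))\<^sup>2 \<le> (Lsq_norm M f + Lsq_norm M g)\<^sup>2"
    unfolding Lsq_norm_add_power2[OF assms] power2_sum by simp
qed simp

lemma Lsq_norm_diff_triangle:
  assumes "f \<in> Lsq M" "g \<in> Lsq M" "h \<in> Lsq M"
  shows "Lsq_norm M (\<lambda>x. f x - h x) \<le> Lsq_norm M (\<lambda>x. f x - g x) + Lsq_norm M (\<lambda>x. g x - h x)"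
  using Lsq_norm_triangle[OF Lsq_diff[OF assms(1,2)] Lsq_diff[OF assms(2,3)]] by simp

text \<open>
  Riesz and Fischer: a subsequence whose consecutive \<open>L\<^sup>2\<close> distances are at most \<open>2\<^sup>-\<^sup>k\<close> converges
  almost everywhere, because on a finite measure space these distances bound the \<open>L\<^sup>1\<close> distances.
  Fatou's lemma makes its pointwise limit the \<open>L\<^sup>2\<close> limit.
\<close>

lemma (in finite_measure) Lsq_complete:
  assumes u: "\<And>n. u n \<in> Lsq M"
    and cauchy: "\<And>\<epsilon>. 0 < \<epsilon> \<Longrightarrow> \<exists>N::nat. \<forall>m\<ge>N. \<forall>n\<ge>N. Lsq_norm M (\<lambda>x. u m x - u n x) < \<epsilon>"
  shows "\<exists>g\<in>Lsq M. (\<lambda>n. Lsq_norm M (\<lambda>x. g x - u n x)) \<longlonglongrightarrow> 0"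
proof -
  have [measurable]: "u n \<in> borel_measurable M" for n
    using u by (rule LsqD)
  have "\<exists>N. \<forall>m\<ge>N. \<forall>n\<ge>N. Lsq_norm M (\<lambda>x. u m x - u n x) < (1/2) ^ k" for k :: nat
    by (rule cauchy) simp
  then obtain N where N: "\<And>k m n. N k \<le> m \<Longrightarrow> N k \<le> n \<Longrightarrow> Lsq_norm M (\<lambda>x. u m x - u n x) < (1/2) ^ k"
    by metis
  \<comment> \<open>Summing the thresholds makes them monotone.\<close>
  define r where "r = (\<lambda>k. \<Sum>i\<le>k. N i)"
  have r1: "N k \<le> r k" for k
    unfolding r_def by (rule member_le_sum) auto
  have r2: "r k \<le> r l" if "k \<le> l" for k l
    unfolding r_def using that by (intro sum_mono2) auto
  define c where "c = Lsq_norm M (\<lambda>x. 1)"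
  have one: "(\<lambda>x. 1) \<in> Lsq M" by (simp add: Lsq_def)
  define w where "w = (\<lambda>k x. u (r (Suc k)) x - u (r k) x)"
  have w: "w k \<in> Lsq M" for k
    unfolding w_def by (intro Lsq_diff u)
  have [measurable]: "w k \<in> borel_measurable M" for k
    using w by (rule LsqD)
  have wabs: "(\<lambda>x. complex_of_real (cmod (w k x))) \<in> Lsq M" for k
    using w[of k] by (auto simp: Lsq_def)
  have wint: "integrable M (\<lambda>x. cmod (w k x))" for k
    using integrable_norm[OF integrable_Lsq_inner[OF wabs[of k] one]] by simp
  have wL1: "(\<integral>x. cmod (w k x) \<partial>M) \<le> (1/2) ^ k * c" for k
  proof -
    have "Lsq_norm M (\<lambda>x. complex_of_real (cmod (w k x))) = Lsq_norm M (w k)"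
      by (simp add: Lsq_norm_def)
    also have "\<dots> \<le> (1/2) ^ k"
      using N[of k "r (Suc k)" "r k"] r1[of k] r2[of k "Suc k"] unfolding w_def by simp
    finally have n: "Lsq_norm M (\<lambda>x. complex_of_real (cmod (w k x))) \<le> (1/2) ^ k" .
    have "(\<integral>x. cmod (w k x) \<partial>M) = cmod (Lsq_inner M (\<lambda>x. complex_of_real (cmod (w k x))) (\<lambda>x. 1))"
      by (simp add: Lsq_inner_def integral_complex_of_real)
    also have "\<dots> \<le> (1/2) ^ k * c"
      unfolding c_def by (rule order_trans[OF Lsq_Cauchy_Schwarz[OF wabs one] mult_right_mono[OF n]]) simp
    finally show ?thesis .
  qed
  have "(\<integral>\<^sup>+x. (\<Sum>k. ennreal (cmod (w k x))) \<partial>M) = (\<Sum>k. \<integral>\<^sup>+x. ennreal (cmod (w k x)) \<partial>M)"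
    by (rule nn_integral_suminf) simp
  also have "\<dots> = (\<Sum>k. ennreal (\<integral>x. cmod (w k x) \<partial>M))"
    using wint by (simp add: nn_integral_eq_integral)
  also have "\<dots> \<le> (\<Sum>k. ennreal ((1/2) ^ k * c))"
    by (intro suminf_le ennreal_leI wL1) auto
  also have "\<dots> = ennreal (\<Sum>k. (1/2) ^ k * c)"
    by (rule suminf_ennreal2) (auto simp: c_def intro!: summable_mult2)
  finally have "(\<integral>\<^sup>+x. (\<Sum>k. ennreal (cmod (w k x))) \<partial>M) \<noteq> \<infinity>"
    by (auto simp: top_unique)
  then have "AE x in M. (\<Sum>k. ennreal (cmod (w k x))) \<noteq> \<infinity>"
    by (intro nn_integral_PInf_AE) auto
  then have conv: "AE x in M. (\<lambda>k. u (r k) x) \<longlonglongrightarrow> lim (\<lambda>k. u (r k) x)"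
  proof eventually_elim
    case (elim x)
    then have "summable (\<lambda>k. cmod (w k x))"
      by (intro summable_suminf_not_top) auto
    then have "summable (\<lambda>k. w k x)" by (rule summable_norm_cancel)
    then have "convergent (\<lambda>n. \<Sum>k<n. w k x)" by (simp add: summable_iff_convergent)
    moreover have "(\<Sum>k<n. w k x) = u (r n) x - u (r 0) x" for n
      unfolding w_def by (rule sum_lessThan_telescope)
    ultimately have "convergent (\<lambda>n. u (r n) x - u (r 0) x)" by simp
    from convergent_add[OF this convergent_const[of "u (r 0) x"]]
    show ?case by (simp add: convergent_LIMSEQ_iff)
  qed
  define g where "g = (\<lambda>x. lim (\<lambda>k. u (r k) x))"
  have [measurable]: "g \<in> borel_measurable M"
    unfolding g_def by (rule borel_measurable_lim_metric) simp
  have fatou: "(\<integral>\<^sup>+x. ennreal ((cmod (g x - u n x))\<^sup>2) \<partial>M) \<le> ennreal (((1/2) ^ k)\<^sup>2)" if n: "r k \<le> n" for k n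
  proof -
    have "(\<integral>\<^sup>+x. ennreal ((cmod (g x - u n x))\<^sup>2) \<partial>M)
        = (\<integral>\<^sup>+x. liminf (\<lambda>j. ennreal ((cmod (u (r j) x - u n x))\<^sup>2)) \<partial>M)"
    proof (rule nn_integral_cong_AE)
      show "AE x in M. ennreal ((cmod (g x - u n x))\<^sup>2) = liminf (\<lambda>j. ennreal ((cmod (u (r j) x - u n x))\<^sup>2))"
        using conv
      proof eventually_elim
        case (elim x)
        then have "(\<lambda>j. ennreal ((cmod (u (r j) x - u n x))\<^sup>2)) \<longlonglongrightarrow> ennreal ((cmod (g x - u n x))\<^sup>2)"
          unfolding g_def by (intro tendsto_ennrealI tendsto_intros)
        then show ?case
          by (intro lim_imp_Liminf[symmetric]) auto
      qed
    qed
    also have "\<dots> \<le> liminf (\<lambda>j. \<integral>\<^sup>+x. ennreal ((cmod (u (r j) x - u n x))\<^sup>2) \<partial>M)"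
      by (rule nn_integral_liminf) simp
    also have "\<dots> \<le> ennreal (((1/2) ^ k)\<^sup>2)"
    proof (rule Liminf_le)
      show "\<forall>\<^sub>F j in sequentially. (\<integral>\<^sup>+x. ennreal ((cmod (u (r j) x - u n x))\<^sup>2) \<partial>M) \<le> ennreal (((1/2) ^ k)\<^sup>2)"
        using eventually_ge_at_top[of k]
      proof eventually_elim
        case (elim j)
        have "Lsq_norm M (\<lambda>x. u (r j) x - u n x) \<le> (1/2) ^ k"
          using N[of k "r j" n] r1[of k] r2[OF elim] n by simp
        then have "(Lsq_norm M (\<lambda>x. u (r j) x - u n x))\<^sup>2 \<le> ((1/2) ^ k)\<^sup>2"
          by (intro power_mono) auto
        then have "(\<integral>x. (cmod (u (r j) x - u n x))\<^sup>2 \<partial>M) \<le> ((1/2) ^ k)\<^sup>2"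
          by (simp add: Lsq_norm_power2)
        then show ?case
          using LsqD(2)[OF Lsq_diff[OF u u], of "r j" n]
          by (subst nn_integral_eq_integral) (auto intro: ennreal_leI)
      qed
    qed simp
    finally show ?thesis .
  qed
  have diffL: "(\<lambda>x. g x - u n x) \<in> Lsq M" if "r k \<le> n" for k n
  proof -
    have "integrable M (\<lambda>x. (cmod (g x - u n x))\<^sup>2)"
      using fatou[OF that] by (intro integrableI_nonneg) (auto simp: le_less_trans)
    then show ?thesis by (simp add: Lsq_def)
  qed
  have bound: "Lsq_norm M (\<lambda>x. g x - u n x) \<le> (1/2) ^ k" if "r k \<le> n" for k n
  proof (rule power2_le_imp_le)
    have "ennreal (\<integral>x. (cmod (g x - u n x))\<^sup>2 \<partial>M) \<le> ennreal (((1/2) ^ k)\<^sup>2)"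
      using fatou[OF that] LsqD(2)[OF diffL[OF that]] by (simp add: nn_integral_eq_integral)
    then show "(Lsq_norm M (\<lambda>x. g x - u n x))\<^sup>2 \<le> ((1/2) ^ k)\<^sup>2"
      unfolding Lsq_norm_power2 by (subst (asm) ennreal_le_iff) auto
  qed simp
  have "g \<in> Lsq M"
    using Lsq_add[OF diffL[of 0 "r 0"] u[of "r 0"]] by simp
  moreover have "(\<lambda>n. Lsq_norm M (\<lambda>x. g x - u n x)) \<longlonglongrightarrow> 0"
  proof (rule LIMSEQ_I)
    fix \<epsilon> :: real assume "0 < \<epsilon>"
    then obtain k where "(1/2) ^ k < \<epsilon>"
      using real_arch_pow_inv[of \<epsilon> "1/2"] by auto
    then show "\<exists>n0. \<forall>n\<ge>n0. norm (Lsq_norm M (\<lambda>x. g x - u n x) - 0) < \<epsilon>"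
      using bound[of k] by (intro exI[of _ "r k"]) (auto intro: le_less_trans)
  qed
  ultimately show ?thesis by blast
qed

section \<open>Orthonormal expansions\<close>

lemma tendsto_0_norm_le:
  assumes "\<And>n :: nat. norm (f n) \<le> (g n :: real)" "g \<longlonglongrightarrow> l" "l = 0"
  shows "f \<longlonglongrightarrow> 0"
  using assms Lim_null_comparison[of f g sequentially] by simp

text \<open>
  The finite sets \<open>D n\<close> exhaust the index set, so that sums over \<open>D n\<close> play the role of the partial
  sums of a series. The choice of \<open>D\<close> does not change which functions are sums, but a choice that
  suits an operator makes it map partial sums to partial sums.
\<close>

locale orthonormal_exhaustion = finite_measure M for M :: "'a measure" +
  fixes e :: "'i \<Rightarrow> 'a \<Rightarrow> complex" and D :: "nat \<Rightarrow> 'i set"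
  assumes e_Lsq: "e k \<in> Lsq M"
    and orthonormal: "Lsq_inner M (e j) (e k) = (if j = k then 1 else 0)"
    and finite_D: "finite (D n)"
    and mono_D: "m \<le> n \<Longrightarrow> D m \<subseteq> D n"
    and exhaust_D: "\<exists>n. k \<in> D n"
begin

definition partial :: "('i \<Rightarrow> complex) \<Rightarrow> nat \<Rightarrow> 'a \<Rightarrow> complex" where
  "partial f n = (\<lambda>x. \<Sum>k\<in>D n. f k * e k x)"

definition expands :: "('i \<Rightarrow> complex) \<Rightarrow> ('a \<Rightarrow> complex) \<Rightarrow> bool" where
  "expands f g \<longleftrightarrow> g \<in> Lsq M \<and> (\<lambda>n. Lsq_norm M (\<lambda>x. g x - partial f n x)) \<longlonglongrightarrow> 0"

text \<open>
  A finite combination of the \<open>e k\<close> is some \<open>partial c n\<close> with coefficients padded by 0, so this is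
  the closure of the linear span.
\<close>

definition closed_span :: "('a \<Rightarrow> complex) set" where
  "closed_span = {h \<in> Lsq M. \<forall>\<epsilon>>0. \<exists>c n. Lsq_norm M (\<lambda>x. h x - partial c n x) < \<epsilon>}"

definition synthesis :: "('i \<Rightarrow> complex) \<Rightarrow> 'a \<Rightarrow> complex" where
  "synthesis f = (SOME g. expands f g)"

lemma partial_Lsq: "partial f n \<in> Lsq M"
  unfolding partial_def by (intro Lsq_sum Lsq_cmult e_Lsq)

lemma partial_lincomb: "partial (\<lambda>k. a * f k + b * g k) n x = a * partial f n x + b * partial g n x"
  by (simp add: partial_def sum.distrib sum_distrib_left algebra_simps)

lemma partial_diff: "partial (\<lambda>k. f k - g k) n x = partial f n x - partial g n x"
  by (simp add: partial_def sum_subtractf algebra_simps)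

lemma partial_truncate:
  assumes "m \<le> n"
  shows "partial (\<lambda>k. if k \<in> D m then f k else 0) n = partial f m"
proof
  fix x
  show "partial (\<lambda>k. if k \<in> D m then f k else 0) n x = partial f m x"
    unfolding partial_def using mono_D[OF assms]
    by (intro sum.mono_neutral_cong_right finite_D) auto
qed

lemma inner_partial_left:
  assumes "g \<in> Lsq M"
  shows "Lsq_inner M (partial f n) g = (\<Sum>k\<in>D n. f k * Lsq_inner M (e k) g)"
  unfolding partial_def using assms
  by (simp add: Lsq_inner_sum_left Lsq_cmult e_Lsq Lsq_inner_cmult_left)

lemma inner_e_partial:
  "Lsq_inner M (e k) (partial f n) = (if k \<in> D n then cnj (f k) else 0)"
proof -
  have "Lsq_inner M (e k) (partial f n) = (\<Sum>j\<in>D n. cnj (f j) * Lsq_inner M (e k) (e j))"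
    unfolding partial_def by (simp add: Lsq_inner_sum_right Lsq_cmult e_Lsq Lsq_inner_cmult_right)
  also have "\<dots> = (\<Sum>j\<in>D n. if k = j then cnj (f j) else 0)"
    by (intro sum.cong) (auto simp: orthonormal)
  also have "\<dots> = (if k \<in> D n then cnj (f k) else 0)"
    by (simp add: finite_D)
  finally show ?thesis .
qed

lemma inner_partial: "Lsq_inner M (partial f n) (partial g n) = (\<Sum>k\<in>D n. f k * cnj (g k))"
  by (simp add: inner_partial_left partial_Lsq inner_e_partial)

lemma norm_partial: "(Lsq_norm M (partial f n))\<^sup>2 = (\<Sum>k\<in>D n. (cmod (f k))\<^sup>2)"
proof -
  have "complex_of_real ((Lsq_norm M (partial f n))\<^sup>2) = of_real (\<Sum>k\<in>D n. (cmod (f k))\<^sup>2)"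
    unfolding Lsq_inner_self[symmetric] inner_partial of_real_sum complex_norm_square ..
  then show ?thesis by (simp only: of_real_eq_iff)
qed

lemma eventually_in_D: "\<forall>\<^sub>F n in sequentially. k \<in> D n"
proof -
  obtain m where "k \<in> D m" using exhaust_D by blast
  then show ?thesis
    using mono_D by (auto simp: eventually_sequentially intro!: exI[of _ m])
qed

lemma truncate_tendsto:
  fixes h :: "'i \<Rightarrow> 'b::real_normed_vector"
  shows "(\<lambda>n. if k \<in> D n then h k else 0) \<longlonglongrightarrow> h k"
  by (intro tendsto_eventually eventually_mono[OF eventually_in_D[of k]]) simp

lemma integral_count_space_truncate:
  fixes h :: "'i \<Rightarrow> 'b::{banach, second_countable_topology}"
  shows "(\<integral>k. (if k \<in> D n then h k else 0) \<partial>count_space UNIV) = (\<Sum>k\<in>D n. h k)"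
proof -
  have fin: "finite {k \<in> UNIV. (if k \<in> D n then h k else 0) \<noteq> 0}"
    by (rule finite_subset[OF _ finite_D[of n]]) auto
  show ?thesis
    by (subst lebesgue_integral_count_space_finite_support[OF fin])
      (auto intro!: sum.mono_neutral_cong_left finite_D)
qed

lemma sum_D_tendsto:
  fixes h :: "'i \<Rightarrow> 'b::{banach, second_countable_topology}"
  assumes h: "integrable (count_space UNIV) h"
  shows "(\<lambda>n. \<Sum>k\<in>D n. h k) \<longlonglongrightarrow> (\<integral>k. h k \<partial>count_space UNIV)"
  unfolding integral_count_space_truncate[symmetric]
proof (rule integral_dominated_convergence[where w = "\<lambda>k. norm (h k)"])
  show "AE k in count_space UNIV. (\<lambda>n. if k \<in> D n then h k else 0) \<longlonglongrightarrow> h k"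
    by (intro AE_I2 truncate_tendsto)
qed (use h in auto)

lemma integrable_count_space_bounded_sums:
  fixes h :: "'i \<Rightarrow> real"
  assumes h: "\<And>k. 0 \<le> h k" and B: "\<And>n. (\<Sum>k\<in>D n. h k) \<le> B"
  shows "integrable (count_space UNIV) h"
proof -
  let ?s = "\<lambda>n k. if k \<in> D n then h k else 0"
  have mono: "incseq (\<lambda>n. \<Sum>k\<in>D n. h k)"
    by (intro incseq_SucI sum_mono2 finite_D mono_D h) auto
  obtain L where L: "(\<lambda>n. \<Sum>k\<in>D n. h k) \<longlonglongrightarrow> L"
    using incseq_convergent[OF mono] B by blast
  show ?thesis
  proof (rule integrable_monotone_convergence)
    show "integrable (count_space UNIV) (?s n)" for n
    proof (rule integrableI_nonneg)
      have "(\<integral>\<^sup>+k. ennreal (?s n k) \<partial>count_space UNIV) = (\<Sum>k\<in>D n. ennreal (?s n k))"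
        by (rule nn_integral_count_space') (use finite_D in auto)
      also have "\<dots> < \<infinity>" using finite_D by simp
      finally show "(\<integral>\<^sup>+k. ennreal (?s n k) \<partial>count_space UNIV) < \<infinity>" .
    qed (use h in auto)
    show "AE k in count_space UNIV. mono (\<lambda>n. ?s n k)"
      using mono_D h by (auto simp: mono_def)
    show "AE k in count_space UNIV. (\<lambda>n. ?s n k) \<longlonglongrightarrow> h k"
      by (intro AE_I2 truncate_tendsto)
    show "(\<lambda>n. \<integral>k. ?s n k \<partial>count_space UNIV) \<longlonglongrightarrow> L"
      unfolding integral_count_space_truncate by (rule L)
  qed simp
qed

text \<open>The squared distance of two partial sums is a difference of partial sums of \<open>|f k|\<^sup>2\<close>.\<close>

lemma expands_exists:
  assumes f: "f \<in> Lsq (count_space UNIV)"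
  shows "\<exists>g. expands f g"
proof -
  define a where "a = (\<lambda>n. \<Sum>k\<in>D n. (cmod (f k))\<^sup>2)"
  have "convergent a"
    using sum_D_tendsto[OF LsqD(2)[OF f]] unfolding a_def by (rule convergentI)
  then have cauchy: "Cauchy a" by (rule convergent_Cauchy)
  have norm_diff: "(Lsq_norm M (\<lambda>x. partial f n x - partial f m x))\<^sup>2 = a n - a m" if "m \<le> n" for m n
  proof -
    have "(\<lambda>x. partial f n x - partial f m x)
        = partial (\<lambda>k. f k - (if k \<in> D m then f k else 0)) n"
      by (simp add: partial_diff fun_eq_iff flip: partial_truncate[OF that])
    then have "(Lsq_norm M (\<lambda>x. partial f n x - partial f m x))\<^sup>2
        = (\<Sum>k\<in>D n. (cmod (f k - (if k \<in> D m then f k else 0)))\<^sup>2)"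
      by (simp add: norm_partial)
    also have "\<dots> = (\<Sum>k\<in>D n. (cmod (f k))\<^sup>2 - (if k \<in> D m then (cmod (f k))\<^sup>2 else 0))"
      by (intro sum.cong) auto
    also have "\<dots> = a n - (\<Sum>k\<in>D n. if k \<in> D m then (cmod (f k))\<^sup>2 else 0)"
      by (simp add: sum_subtractf a_def)
    also have "(\<Sum>k\<in>D n. if k \<in> D m then (cmod (f k))\<^sup>2 else 0) = a m"
      unfolding a_def using mono_D[OF that]
      by (intro sum.mono_neutral_cong_right finite_D) auto
    finally show ?thesis .
  qed
  have "\<exists>g\<in>Lsq M. (\<lambda>n. Lsq_norm M (\<lambda>x. g x - partial f n x)) \<longlonglongrightarrow> 0"
  proof (rule Lsq_complete[OF partial_Lsq])
    fix \<epsilon> :: real assume \<epsilon>: "0 < \<epsilon>"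
    then obtain N where N: "\<And>m n. N \<le> m \<Longrightarrow> N \<le> n \<Longrightarrow> norm (a m - a n) < \<epsilon>\<^sup>2"
      using cauchy unfolding Cauchy_iff by (metis zero_less_power)
    have "Lsq_norm M (\<lambda>x. partial f n x - partial f m x) < \<epsilon>" if "N \<le> m" "m \<le> n" for m n
    proof (rule power2_less_imp_less)
      show "(Lsq_norm M (\<lambda>x. partial f n x - partial f m x))\<^sup>2 < \<epsilon>\<^sup>2"
        using N[of n m] that norm_diff[of m n] by (auto simp: abs_less_iff)
    qed (use \<epsilon> in simp)
    then show "\<exists>N. \<forall>m\<ge>N. \<forall>n\<ge>N. Lsq_norm M (\<lambda>x. partial f m x - partial f n x) < \<epsilon>"
      using Lsq_norm_minus_commute[of M] by (metis nle_le)
  qed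
  then show ?thesis by (auto simp: expands_def)
qed

lemma expands_unique:
  assumes "expands f g" "expands f g'"
  shows "AE x in M. g x = g' x"
proof -
  have L: "g \<in> Lsq M" "g' \<in> Lsq M" using assms by (auto simp: expands_def)
  have "(\<lambda>n. Lsq_norm M (\<lambda>x. g x - partial f n x) + Lsq_norm M (\<lambda>x. partial f n x - g' x)) \<longlonglongrightarrow> 0 + 0"
    using assms unfolding Lsq_norm_minus_commute[of M "partial f _" g']
    by (intro tendsto_add) (auto simp: expands_def)
  moreover have "\<And>n. Lsq_norm M (\<lambda>x. g x - g' x) \<le>
      Lsq_norm M (\<lambda>x. g x - partial f n x) + Lsq_norm M (\<lambda>x. partial f n x - g' x)"
    by (intro Lsq_norm_diff_triangle L partial_Lsq)
  ultimately have "Lsq_norm M (\<lambda>x. g x - g' x) \<le> 0"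
    by (intro LIMSEQ_le_const) auto
  then have "Lsq_norm M (\<lambda>x. g x - g' x) = 0"
    by (intro antisym) auto
  then have "AE x in M. g x - g' x = 0"
    by (intro Lsq_norm_eq_0_AE[of "\<lambda>x. g x - g' x"] Lsq_diff L)
  then show ?thesis by simp
qed

lemma expands_lincomb:
  assumes "expands f g" "expands f' g'"
  shows "expands (\<lambda>k. a * f k + b * f' k) (\<lambda>x. a * g x + b * g' x)"
proof -
  have L: "g \<in> Lsq M" "g' \<in> Lsq M"
    and lim: "(\<lambda>n. Lsq_norm M (\<lambda>x. g x - partial f n x)) \<longlonglongrightarrow> 0"
      "(\<lambda>n. Lsq_norm M (\<lambda>x. g' x - partial f' n x)) \<longlonglongrightarrow> 0"
    using assms unfolding expands_def by blast+
  have "norm (Lsq_norm M (\<lambda>x. (a * g x + b * g' x) - partial (\<lambda>k. a * f k + b * f' k) n x))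
      \<le> cmod a * Lsq_norm M (\<lambda>x. g x - partial f n x) + cmod b * Lsq_norm M (\<lambda>x. g' x - partial f' n x)" for n
  proof -
    have "(\<lambda>x. (a * g x + b * g' x) - partial (\<lambda>k. a * f k + b * f' k) n x)
        = (\<lambda>x. a * (g x - partial f n x) + b * (g' x - partial f' n x))"
      by (simp add: partial_lincomb algebra_simps)
    then show ?thesis
      using Lsq_norm_triangle[of "\<lambda>x. a * (g x - partial f n x)" M "\<lambda>x. b * (g' x - partial f' n x)"]
      by (simp add: Lsq_norm_cmult Lsq_cmult Lsq_diff L partial_Lsq)
  qed
  moreover have "(\<lambda>n. cmod a * Lsq_norm M (\<lambda>x. g x - partial f n x)
      + cmod b * Lsq_norm M (\<lambda>x. g' x - partial f' n x)) \<longlonglongrightarrow> cmod a * 0 + cmod b * 0"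
    by (intro tendsto_add[OF tendsto_mult[OF tendsto_const lim(1)] tendsto_mult[OF tendsto_const lim(2)]])
  ultimately have "(\<lambda>n. Lsq_norm M (\<lambda>x. (a * g x + b * g' x) - partial (\<lambda>k. a * f k + b * f' k) n x)) \<longlonglongrightarrow> 0"
    by (rule tendsto_0_norm_le) simp
  then show ?thesis
    by (auto simp: expands_def intro!: Lsq_add Lsq_cmult L)
qed

lemma expands_inner:
  assumes f: "f \<in> Lsq (count_space UNIV)" "f' \<in> Lsq (count_space UNIV)"
    and g: "expands f g" "expands f' g'"
  shows "Lsq_inner M g g' = Lsq_inner (count_space UNIV) f f'"
proof -
  have L: "g \<in> Lsq M" "g' \<in> Lsq M" using g by (auto simp: expands_def)
  define d where "d = (\<lambda>n. Lsq_norm M (\<lambda>x. g x - partial f n x))"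
  define d' where "d' = (\<lambda>n. Lsq_norm M (\<lambda>x. g' x - partial f' n x))"
  have d: "d \<longlonglongrightarrow> 0" "d' \<longlonglongrightarrow> 0" using g by (auto simp: expands_def d_def d'_def)
  have "cmod (Lsq_inner M g g' - Lsq_inner M (partial f n) (partial f' n))
      \<le> d n * Lsq_norm M g' + (Lsq_norm M g + d n) * d' n" for n
  proof -
    have "Lsq_inner M g g' - Lsq_inner M (partial f n) (partial f' n)
        = Lsq_inner M (\<lambda>x. g x - partial f n x) g' + Lsq_inner M (partial f n) (\<lambda>x. g' x - partial f' n x)"
      by (simp add: Lsq_inner_diff_left Lsq_inner_diff_right L partial_Lsq)
    also have "cmod \<dots> \<le> d n * Lsq_norm M g' + Lsq_norm M (partial f n) * d' n"
      unfolding d_def d'_def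
      by (intro norm_triangle_le add_mono Lsq_Cauchy_Schwarz Lsq_diff L partial_Lsq)
    also have "Lsq_norm M (partial f n) \<le> Lsq_norm M g + d n"
      using Lsq_norm_triangle[of g M "\<lambda>x. partial f n x - g x"] L partial_Lsq[of f n]
      by (simp add: Lsq_diff d_def Lsq_norm_minus_commute[of M g])
    finally show ?thesis
      by (simp add: mult_right_mono d'_def)
  qed
  moreover have "(\<lambda>n. d n * Lsq_norm M g' + (Lsq_norm M g + d n) * d' n) \<longlonglongrightarrow> 0 * Lsq_norm M g' + (Lsq_norm M g + 0) * 0"
    by (intro tendsto_add[OF tendsto_mult[OF d(1) tendsto_const]]
        tendsto_mult[OF tendsto_add[OF tendsto_const d(1)] d(2)])
  ultimately have "(\<lambda>n. Lsq_inner M g g' - Lsq_inner M (partial f n) (partial f' n)) \<longlonglongrightarrow> 0"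
    by (rule tendsto_0_norm_le) simp
  then have "(\<lambda>n. Lsq_inner M g g' - (Lsq_inner M g g' - Lsq_inner M (partial f n) (partial f' n)))
      \<longlonglongrightarrow> Lsq_inner M g g' - 0"
    by (intro tendsto_diff tendsto_const)
  then have "(\<lambda>n. \<Sum>k\<in>D n. f k * cnj (f' k)) \<longlonglongrightarrow> Lsq_inner M g g'"
    by (simp add: inner_partial)
  moreover have "(\<lambda>n. \<Sum>k\<in>D n. f k * cnj (f' k)) \<longlonglongrightarrow> Lsq_inner (count_space UNIV) f f'"
    unfolding Lsq_inner_def by (intro sum_D_tendsto integrable_Lsq_inner f)
  ultimately show ?thesis by (rule LIMSEQ_unique)
qed

text \<open>
  Among all combinations of \<open>e k\<close>, \<open>k \<in> D n\<close>, the one with the Fourier coefficients of \<open>h\<close> is closest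
  to \<open>h\<close>, since its error is orthogonal to all of them.
\<close>

lemma norm_diff_partial:
  assumes h: "h \<in> Lsq M"
  defines "f \<equiv> (\<lambda>k. Lsq_inner M h (e k))"
  shows "(Lsq_norm M (\<lambda>x. h x - partial c n x))\<^sup>2
    = (Lsq_norm M (\<lambda>x. h x - partial f n x))\<^sup>2 + (\<Sum>k\<in>D n. (cmod (f k - c k))\<^sup>2)"
proof -
  let ?r = "\<lambda>x. h x - partial f n x"
  have r: "?r \<in> Lsq M" by (intro Lsq_diff h partial_Lsq)
  have "Lsq_inner M (partial (\<lambda>k. f k - c k) n) ?r = 0"
    unfolding inner_partial_left[OF r]
  proof (rule sum.neutral, rule ballI)
    fix k assume "k \<in> D n"
    then have "Lsq_inner M (e k) ?r = Lsq_inner M (e k) h - cnj (f k)"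
      by (simp add: Lsq_inner_diff_right h partial_Lsq e_Lsq inner_e_partial)
    also have "\<dots> = 0"
      by (simp add: f_def Lsq_inner_cnj h e_Lsq)
    finally show "(f k - c k) * Lsq_inner M (e k) ?r = 0" by simp
  qed
  then have orth: "Lsq_inner M ?r (partial (\<lambda>k. f k - c k) n) = 0"
    using Lsq_inner_cnj[OF partial_Lsq r, of "\<lambda>k. f k - c k" n] by simp
  have "(\<lambda>x. h x - partial c n x) = (\<lambda>x. ?r x + partial (\<lambda>k. f k - c k) n x)"
    by (simp add: partial_diff)
  then show ?thesis
    by (simp add: Lsq_norm_add_power2[OF r partial_Lsq] orth norm_partial)
qed

lemma expands_coefficients:
  assumes h: "h \<in> closed_span"
  defines "f \<equiv> (\<lambda>k. Lsq_inner M h (e k))"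
  shows "f \<in> Lsq (count_space UNIV)" "expands f h"
proof -
  have hL: "h \<in> Lsq M" using h by (simp add: closed_span_def)
  have "(\<Sum>k\<in>D n. (cmod (f k))\<^sup>2) \<le> (Lsq_norm M h)\<^sup>2" for n
    using norm_diff_partial[OF hL, of "\<lambda>_. 0" n] by (simp add: partial_def[of "\<lambda>_. 0"] f_def)
  then have "integrable (count_space UNIV) (\<lambda>k. (cmod (f k))\<^sup>2)"
    by (intro integrable_count_space_bounded_sums) auto
  then show "f \<in> Lsq (count_space UNIV)" by (simp add: Lsq_def)
  have "(\<lambda>n. Lsq_norm M (\<lambda>x. h x - partial f n x)) \<longlonglongrightarrow> 0"
  proof (rule LIMSEQ_I)
    fix \<epsilon> :: real assume "0 < \<epsilon>"
    then obtain c m where cm: "Lsq_norm M (\<lambda>x. h x - partial c m x) < \<epsilon>"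
      using h by (auto simp: closed_span_def)
    have "Lsq_norm M (\<lambda>x. h x - partial f n x) < \<epsilon>" if "m \<le> n" for n
    proof -
      have "(Lsq_norm M (\<lambda>x. h x - partial f n x))\<^sup>2
          \<le> (Lsq_norm M (\<lambda>x. h x - partial (\<lambda>k. if k \<in> D m then c k else 0) n x))\<^sup>2"
        unfolding norm_diff_partial[OF hL, of "\<lambda>k. if k \<in> D m then c k else 0"] f_def
        by (simp add: sum_nonneg)
      then have "Lsq_norm M (\<lambda>x. h x - partial f n x) \<le> Lsq_norm M (\<lambda>x. h x - partial c m x)"
        unfolding partial_truncate[OF that] by (rule power2_le_imp_le) simp
      then show ?thesis using cm by simp
    qed
    then show "\<exists>n0. \<forall>n\<ge>n0. norm (Lsq_norm M (\<lambda>x. h x - partial f n x) - 0) < \<epsilon>"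
      by (auto intro!: exI[of _ m])
  qed
  then show "expands f h" using hL by (simp add: expands_def)
qed

lemma expands_synthesis:
  "f \<in> Lsq (count_space UNIV) \<Longrightarrow> expands f (synthesis f)"
  unfolding synthesis_def using expands_exists by (rule someI_ex)

lemma expands_in_closed_span:
  assumes "expands f g"
  shows "g \<in> closed_span"
  unfolding closed_span_def
proof (safe intro!: CollectI)
  show "g \<in> Lsq M" using assms by (simp add: expands_def)
  fix \<epsilon> :: real assume "0 < \<epsilon>"
  moreover have "(\<lambda>n. Lsq_norm M (\<lambda>x. g x - partial f n x)) \<longlonglongrightarrow> 0"
    using assms by (simp add: expands_def)
  ultimately have "\<forall>\<^sub>F n in sequentially. Lsq_norm M (\<lambda>x. g x - partial f n x) < \<epsilon>"
    by (simp add: order_tendstoD(2))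
  then show "\<exists>c n. Lsq_norm M (\<lambda>x. g x - partial c n x) < \<epsilon>"
    by (auto simp: eventually_sequentially)
qed

text \<open>
  Synthesis is well defined by completeness, linear and isometric because an expansion determines
  its sum up to a null set, and onto because every element of the closed span is the sum of its own
  Fourier expansion.
\<close>

theorem unitary_synthesis:
  "unitary_between (count_space UNIV) (Lsq (count_space UNIV)) M closed_span synthesis"
  unfolding unitary_between_def
proof (intro conjI ballI allI)
  show "synthesis \<in> Lsq (count_space UNIV) \<rightarrow> closed_span"
    using expands_synthesis expands_in_closed_span by blast
next
  fix f g :: "'i \<Rightarrow> complex" and a b assume fg: "f \<in> Lsq (count_space UNIV)" "g \<in> Lsq (count_space UNIV)"
  show "AE y in M. synthesis (\<lambda>x. a * f x + b * g x) y = a * synthesis f y + b * synthesis g y"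
    by (intro expands_unique[OF expands_synthesis expands_lincomb] expands_synthesis Lsq_add Lsq_cmult fg)
  show "Lsq_inner M (synthesis f) (synthesis g) = Lsq_inner (count_space UNIV) f g"
    by (intro expands_inner expands_synthesis fg)
next
  fix h assume "h \<in> closed_span"
  from expands_coefficients[OF this]
  show "\<exists>f\<in>Lsq (count_space UNIV). AE y in M. synthesis f y = h y"
    using expands_unique expands_synthesis by blast
qed

end

section \<open>The Hardy space of the sphere\<close>

text \<open>
  The exhaustion by total degree suits both coordinates at once: multiplication by either of them
  takes the partial sum of index \<open>n\<close> to a full partial sum of index \<open>n + 1\<close>, which would fail for
  squares of indices.
\<close>

definition degree_le :: "nat \<Rightarrow> (nat \<times> nat) set" where
  "degree_le n = {(a, b). a + b \<le> n}"

definition hardy_basis :: "nat \<times> nat \<Rightarrow> complex \<times> complex \<Rightarrow> complex" where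
  "hardy_basis = (\<lambda>(a, b) z. holo_monomial a b z / of_real (sqrt (surface_moment a b)))"

lemma surface_moment_pos: "0 < surface_moment a b"
  by (simp add: surface_moment_eq)

lemma degree_le_subset: "degree_le n \<subseteq> {..n} \<times> {..n}"
  by (auto simp: degree_le_def)

lemma finite_degree_le: "finite (degree_le n)"
  using degree_le_subset by (rule finite_subset) simp

lemma continuous_Lsq_surface_S3:
  assumes "continuous_on UNIV F"
  shows "F \<in> Lsq normalized_surface_S3"
  using borel_measurable_integrable[OF integrable_surface_S3[OF assms]]
  by (auto simp: Lsq_def intro!: integrable_surface_S3 continuous_intros assms)

interpretation hardy: orthonormal_exhaustion normalized_surface_S3 hardy_basis degree_le
proof
  fix k :: "nat \<times> nat"
  show "hardy_basis k \<in> Lsq normalized_surface_S3"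
    unfolding hardy_basis_def divide_inverse split_beta
    by (intro continuous_Lsq_surface_S3 continuous_intros)
  show "\<exists>n. k \<in> degree_le n"
    by (cases k) (auto simp: degree_le_def)
next
  fix j k :: "nat \<times> nat"
  obtain a b a' b' where jk: "j = (a, b)" "k = (a', b')" by fastforce
  have "Lsq_inner normalized_surface_S3 (hardy_basis j) (hardy_basis k)
      = (\<integral>z. holo_monomial a b z * cnj (holo_monomial a' b' z) /
          (of_real (sqrt (surface_moment a b)) * of_real (sqrt (surface_moment a' b')))
          \<partial>normalized_surface_S3)"
    by (simp add: Lsq_inner_def hardy_basis_def jk)
  also have "\<dots> = (\<integral>z. holo_monomial a b z * cnj (holo_monomial a' b' z) \<partial>normalized_surface_S3) /
      (of_real (sqrt (surface_moment a b)) * of_real (sqrt (surface_moment a' b')))"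
    by (rule integral_divide_zero)
  also have "\<dots> = (if j = k then 1 else 0)"
    using surface_moment_pos[of a b] unfolding integral_holo_monomial
    by (auto simp: jk simp flip: of_real_mult)
  finally show "Lsq_inner normalized_surface_S3 (hardy_basis j) (hardy_basis k) = (if j = k then 1 else 0)" .
next
  show "finite (degree_le n)" for n
    by (rule finite_degree_le)
  show "degree_le m \<subseteq> degree_le n" if "m \<le> n" for m n
    using that by (auto simp: degree_le_def)
qed

lemma partial_holomorphic_polynomial: "hardy.partial c n \<in> holomorphic_polynomials"
proof -
  let ?c = "\<lambda>i j. if i + j \<le> n then c (i, j) / of_real (sqrt (surface_moment i j)) else 0"
  have "hardy.partial c n (z1, z2) = (\<Sum>i\<le>n. \<Sum>j\<le>n. ?c i j * z1 ^ i * z2 ^ j)" for z1 z2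
    unfolding hardy.partial_def sum.cartesian_product
    by (rule sum.mono_neutral_cong_left)
      (auto simp: degree_le_def hardy_basis_def holo_monomial_def split: if_splits)
  then show ?thesis
    unfolding holomorphic_polynomials_def by (intro CollectI exI[of _ n] exI[of _ ?c] allI)
qed

lemma holomorphic_polynomial_partial:
  assumes "p \<in> holomorphic_polynomials"
  shows "\<exists>c n. p = hardy.partial c n"
proof -
  obtain n c where p: "\<And>z1 z2. p (z1, z2) = (\<Sum>i\<le>n. \<Sum>j\<le>n. c i j * z1 ^ i * z2 ^ (j::nat))"
    using assms by (auto simp: holomorphic_polynomials_def)
  let ?c = "\<lambda>(i, j). if i \<le> n \<and> j \<le> n then c i j * of_real (sqrt (surface_moment i j)) else 0"
  have nz: "surface_moment i j \<noteq> 0" for i j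
    using surface_moment_pos[of i j] by simp
  have "p (z1, z2) = hardy.partial ?c (2 * n) (z1, z2)" for z1 z2
    unfolding p hardy.partial_def sum.cartesian_product
    by (rule sum.mono_neutral_cong_left)
      (auto simp: finite_degree_le[unfolded degree_le_def] degree_le_def hardy_basis_def holo_monomial_def nz
        split: if_splits)
  then show ?thesis by (intro exI[of _ ?c] exI[of _ "2 * n"]) auto
qed

lemma hardy_S3_eq_closed_span: "hardy_S3 = hardy.closed_span"
  unfolding hardy_S3_def hardy.closed_span_def
  using partial_holomorphic_polynomial holomorphic_polynomial_partial by (auto; metis)

section \<open>The shifts as multiplication by the coordinates\<close>

text \<open>The weights of the spherically isometric embedding in closed form.\<close>

definition alpha_weight :: "nat \<Rightarrow> nat \<Rightarrow> real" where
  "alpha_weight a b = sqrt ((real a + 1) / (real a + real b + 2))"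

definition beta_weight :: "nat \<Rightarrow> nat \<Rightarrow> real" where
  "beta_weight a b = sqrt ((real b + 1) / (real a + real b + 2))"

lemma sum_degree_le_shift1:
  assumes "\<And>b. h (0, b) = 0"
  shows "(\<Sum>k\<in>degree_le (Suc n). h k) = (\<Sum>(a, b)\<in>degree_le n. h (Suc a, b))"
proof -
  have "(\<Sum>(a, b)\<in>degree_le n. h (Suc a, b)) = (\<Sum>k\<in>(\<lambda>(a, b). (Suc a, b)) ` degree_le n. h k)"
    by (subst sum.reindex) (auto simp: inj_on_def split_beta)
  also have "\<dots> = (\<Sum>k\<in>degree_le (Suc n). h k)"
  proof (rule sum.mono_neutral_left)
    show "\<forall>k\<in>degree_le (Suc n) - (\<lambda>(a, b). (Suc a, b)) ` degree_le n. h k = 0"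
    proof
      fix k assume k: "k \<in> degree_le (Suc n) - (\<lambda>(a, b). (Suc a, b)) ` degree_le n"
      obtain a b where ab: "k = (a, b)" by (cases k)
      show "h k = 0" using k assms by (cases a) (auto simp: ab degree_le_def image_iff)
    qed
  qed (auto simp: finite_degree_le[unfolded degree_le_def] degree_le_def)
  finally show ?thesis ..
qed

lemma sum_degree_le_shift2:
  assumes "\<And>a. h (a, 0) = 0"
  shows "(\<Sum>k\<in>degree_le (Suc n). h k) = (\<Sum>(a, b)\<in>degree_le n. h (a, Suc b))"
proof -
  have "(\<Sum>(a, b)\<in>degree_le n. h (a, Suc b)) = (\<Sum>k\<in>(\<lambda>(a, b). (a, Suc b)) ` degree_le n. h k)"
    by (subst sum.reindex) (auto simp: inj_on_def split_beta)
  also have "\<dots> = (\<Sum>k\<in>degree_le (Suc n). h k)"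
  proof (rule sum.mono_neutral_left)
    show "\<forall>k\<in>degree_le (Suc n) - (\<lambda>(a, b). (a, Suc b)) ` degree_le n. h k = 0"
    proof
      fix k assume k: "k \<in> degree_le (Suc n) - (\<lambda>(a, b). (a, Suc b)) ` degree_le n"
      obtain a b where ab: "k = (a, b)" by (cases k)
      show "h k = 0" using k assms by (cases b) (auto simp: ab degree_le_def image_iff)
    qed
  qed (auto simp: finite_degree_le[unfolded degree_le_def] degree_le_def)
  finally show ?thesis ..
qed

lemma surface_moment_Suc1:
  "surface_moment (Suc a) b = (alpha_weight a b)\<^sup>2 * surface_moment a b"
  by (simp add: surface_moment_eq alpha_weight_def field_simps)

lemma surface_moment_Suc2:
  "surface_moment a (Suc b) = (beta_weight a b)\<^sup>2 * surface_moment a b"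
  by (simp add: surface_moment_eq beta_weight_def field_simps)

lemma hardy_basis_mult1:
  "fst z * hardy_basis (a, b) z = of_real (alpha_weight a b) * hardy_basis (Suc a, b) z"
proof -
  have "0 < alpha_weight a b" by (simp add: alpha_weight_def)
  then have "sqrt (surface_moment (Suc a) b) = alpha_weight a b * sqrt (surface_moment a b)"
    by (simp add: surface_moment_Suc1 real_sqrt_mult)
  then show ?thesis
    using \<open>0 < alpha_weight a b\<close> by (simp add: hardy_basis_def holo_monomial_def)
qed

lemma hardy_basis_mult2:
  "snd z * hardy_basis (a, b) z = of_real (beta_weight a b) * hardy_basis (a, Suc b) z"
proof -
  have "0 < beta_weight a b" by (simp add: beta_weight_def)
  then have "sqrt (surface_moment a (Suc b)) = beta_weight a b * sqrt (surface_moment a b)"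
    by (simp add: surface_moment_Suc2 real_sqrt_mult)
  then show ?thesis
    using \<open>0 < beta_weight a b\<close> by (simp add: hardy_basis_def holo_monomial_def)
qed

lemma partial_shift1: "hardy.partial (shift1 alpha_weight f) (Suc n) z = fst z * hardy.partial f n z"
proof -
  have "hardy.partial (shift1 alpha_weight f) (Suc n) z
      = (\<Sum>(a, b)\<in>degree_le n. shift1 alpha_weight f (Suc a, b) * hardy_basis (Suc a, b) z)"
    unfolding hardy.partial_def by (rule sum_degree_le_shift1) (simp add: shift1_def)
  also have "\<dots> = (\<Sum>(a, b)\<in>degree_le n. fst z * (f (a, b) * hardy_basis (a, b) z))"
    by (intro sum.cong) (auto simp: shift1_def hardy_basis_mult1 mult.left_commute mult.commute)
  also have "\<dots> = fst z * hardy.partial f n z"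
    by (simp add: hardy.partial_def sum_distrib_left split_beta)
  finally show ?thesis .
qed

lemma partial_shift2: "hardy.partial (shift2 beta_weight f) (Suc n) z = snd z * hardy.partial f n z"
proof -
  have "hardy.partial (shift2 beta_weight f) (Suc n) z
      = (\<Sum>(a, b)\<in>degree_le n. shift2 beta_weight f (a, Suc b) * hardy_basis (a, Suc b) z)"
    unfolding hardy.partial_def by (rule sum_degree_le_shift2) (simp add: shift2_def)
  also have "\<dots> = (\<Sum>(a, b)\<in>degree_le n. snd z * (f (a, b) * hardy_basis (a, b) z))"
    by (intro sum.cong) (auto simp: shift2_def hardy_basis_mult2 mult.left_commute mult.commute)
  also have "\<dots> = snd z * hardy.partial f n z"
    by (simp add: hardy.partial_def sum_distrib_left split_beta)
  finally show ?thesis .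
qed

text \<open>Only the values of \<open>w\<close> on the sphere matter, because the surface measure is carried by it.\<close>

lemma mult_contraction:
  assumes w: "continuous_on UNIV w" "\<And>z. z \<in> sphere_S3 \<Longrightarrow> cmod (w z) \<le> 1"
    and f: "f \<in> Lsq normalized_surface_S3"
  shows "mult_op w f \<in> Lsq normalized_surface_S3"
    and "Lsq_norm normalized_surface_S3 (mult_op w f) \<le> Lsq_norm normalized_surface_S3 f"
proof -
  have [measurable]: "f \<in> borel_measurable normalized_surface_S3" using f by (rule LsqD)
  have [measurable]: "w \<in> borel_measurable normalized_surface_S3"
    using borel_measurable_continuous_onI[OF w(1)] by simp
  have m: "mult_op w f \<in> borel_measurable normalized_surface_S3"
    unfolding mult_op_def by measurable
  have le: "cmod (mult_op w f z) \<le> cmod (f z)" if "z \<in> sphere_S3" for z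
    unfolding mult_op_def norm_mult using w(2)[OF that] by (simp add: mult_left_le_one_le)
  then have ae: "AE z in normalized_surface_S3. cmod (mult_op w f z) \<le> cmod (f z)"
    using AE_surface_S3 by auto
  have "integrable normalized_surface_S3 (\<lambda>z. (cmod (mult_op w f z))\<^sup>2)"
    using m ae by (intro Bochner_Integration.integrable_bound[OF LsqD(2)[OF f]])
      (auto elim!: eventually_mono intro: power_mono)
  then show "mult_op w f \<in> Lsq normalized_surface_S3"
    using m by (simp add: Lsq_def)
  show "Lsq_norm normalized_surface_S3 (mult_op w f) \<le> Lsq_norm normalized_surface_S3 f"
    by (rule Lsq_norm_mono[OF m f ae])
qed

lemma cmod_coordinate_le:
  assumes "z \<in> sphere_S3"
  shows "cmod (fst z) \<le> 1" "cmod (snd z) \<le> 1"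
proof -
  have "(cmod (fst z))\<^sup>2 + (cmod (snd z))\<^sup>2 = 1"
    using assms by (auto simp: sphere_S3_def)
  then have "(cmod (fst z))\<^sup>2 \<le> 1\<^sup>2" "(cmod (snd z))\<^sup>2 \<le> 1\<^sup>2"
    using zero_le_power2[of "cmod (fst z)"] zero_le_power2[of "cmod (snd z)"]
    unfolding one_power2 by linarith+
  then show "cmod (fst z) \<le> 1" "cmod (snd z) \<le> 1"
    by (auto intro: power2_le_imp_le)
qed

text \<open>
  On partial sums, the shift \<open>f \<mapsto> F\<close> and the multiplication by \<open>w\<close> agree up to one step in \<open>n\<close>;
  a contraction carries this over to the limits.
\<close>

lemma expands_mult:
  assumes w: "continuous_on UNIV w" "\<And>z. z \<in> sphere_S3 \<Longrightarrow> cmod (w z) \<le> 1"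
    and F: "\<And>n z. hardy.partial F (Suc n) z = w z * hardy.partial f n z"
    and g: "hardy.expands f g"
  shows "hardy.expands F (mult_op w g)"
proof -
  have gL: "g \<in> Lsq normalized_surface_S3"
    and lim: "(\<lambda>n. Lsq_norm normalized_surface_S3 (\<lambda>z. g z - hardy.partial f n z)) \<longlonglongrightarrow> 0"
    using g by (auto simp: hardy.expands_def)
  have "norm (Lsq_norm normalized_surface_S3 (\<lambda>z. mult_op w g z - hardy.partial F (Suc n) z))
      \<le> Lsq_norm normalized_surface_S3 (\<lambda>z. g z - hardy.partial f n z)" for n
    using mult_contraction(2)[OF w Lsq_diff[OF gL hardy.partial_Lsq[of f n]]]
    by (simp add: F mult_op_def right_diff_distrib)
  then have "(\<lambda>n. Lsq_norm normalized_surface_S3 (\<lambda>z. mult_op w g z - hardy.partial F (Suc n) z)) \<longlonglongrightarrow> 0"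
    by (rule tendsto_0_norm_le[OF _ lim]) simp
  then have "(\<lambda>n. Lsq_norm normalized_surface_S3 (\<lambda>z. mult_op w g z - hardy.partial F n z)) \<longlonglongrightarrow> 0"
    by (rule LIMSEQ_imp_Suc)
  then show ?thesis
    using mult_contraction(1)[OF w gL] by (simp add: hardy.expands_def)
qed

text \<open>
  Every function in the Hardy space is the sum of its expansion, and the product with \<open>w\<close> is then
  the sum of the shifted one.
\<close>

lemma mult_op_hardy:
  assumes w: "continuous_on UNIV w" "\<And>z. z \<in> sphere_S3 \<Longrightarrow> cmod (w z) \<le> 1"
    and T: "\<And>f n z. hardy.partial (T f) (Suc n) z = w z * hardy.partial f n z"
  shows "mult_op w \<in> hardy_S3 \<rightarrow> hardy_S3"
proof
  fix h assume "h \<in> hardy_S3"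
  then have "hardy.expands (\<lambda>k. Lsq_inner normalized_surface_S3 h (hardy_basis k)) h"
    unfolding hardy_S3_eq_closed_span by (rule hardy.expands_coefficients)
  from expands_mult[of w, OF w T this] show "mult_op w h \<in> hardy_S3"
    unfolding hardy_S3_eq_closed_span by (rule hardy.expands_in_closed_span)
qed

text \<open>
  The norms in \<open>\<ell>\<^sup>2\<close> are limits of sums over \<open>degree_le n\<close>, and the limit does not see a shift of
  \<open>n\<close> by one.
\<close>

lemma grid_contraction:
  assumes "\<And>n. (\<Sum>k\<in>degree_le (Suc n). (cmod (T k))\<^sup>2) \<le> (\<Sum>k\<in>degree_le n. (cmod (f k))\<^sup>2)"
    and f: "f \<in> Lsq grid"
  shows "T \<in> Lsq grid" "Lsq_norm grid T \<le> Lsq_norm grid f"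
proof -
  have bound: "(\<Sum>k\<in>degree_le n. (cmod (f k))\<^sup>2) \<le> (Lsq_norm grid f)\<^sup>2" for n
  proof (rule incseq_le)
    show "incseq (\<lambda>n. \<Sum>k\<in>degree_le n. (cmod (f k))\<^sup>2)"
      by (intro incseq_SucI sum_mono2 hardy.finite_D hardy.mono_D) auto
    show "(\<lambda>n. \<Sum>k\<in>degree_le n. (cmod (f k))\<^sup>2) \<longlonglongrightarrow> (Lsq_norm grid f)\<^sup>2"
      unfolding Lsq_norm_power2 by (rule hardy.sum_D_tendsto[OF LsqD(2)[OF f]])
  qed
  have T: "(\<Sum>k\<in>degree_le n. (cmod (T k))\<^sup>2) \<le> (Lsq_norm grid f)\<^sup>2" for n
  proof -
    have "(\<Sum>k\<in>degree_le n. (cmod (T k))\<^sup>2) \<le> (\<Sum>k\<in>degree_le (Suc n). (cmod (T k))\<^sup>2)"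
      by (intro sum_mono2 hardy.finite_D hardy.mono_D) auto
    also note assms(1)
    also note bound
    finally show ?thesis .
  qed
  have int: "integrable grid (\<lambda>k. (cmod (T k))\<^sup>2)"
    by (rule hardy.integrable_count_space_bounded_sums[OF _ T]) simp
  then show "T \<in> Lsq grid" by (simp add: Lsq_def)
  have "(Lsq_norm grid T)\<^sup>2 \<le> (Lsq_norm grid f)\<^sup>2"
    unfolding Lsq_norm_power2[of grid T]
    by (rule LIMSEQ_le_const2[OF hardy.sum_D_tendsto[OF int]]) (use T in auto)
  then show "Lsq_norm grid T \<le> Lsq_norm grid f"
    by (rule power2_le_imp_le) simp
qed

lemma alpha_weight_bounds: "0 < alpha_weight a b" "alpha_weight a b \<le> 1"
  by (auto simp: alpha_weight_def)

lemma beta_weight_bounds: "0 < beta_weight a b" "beta_weight a b \<le> 1"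
  by (auto simp: beta_weight_def)

lemma shift1_contraction:
  assumes "f \<in> Lsq grid"
  shows "shift1 alpha_weight f \<in> Lsq grid" "Lsq_norm grid (shift1 alpha_weight f) \<le> Lsq_norm grid f"
proof -
  have "(\<Sum>k\<in>degree_le (Suc n). (cmod (shift1 alpha_weight f k))\<^sup>2) \<le> (\<Sum>k\<in>degree_le n. (cmod (f k))\<^sup>2)" for n
    using alpha_weight_bounds
    by (subst sum_degree_le_shift1)
      (auto simp: shift1_def norm_mult power_mult_distrib less_imp_le power_le_one intro!: sum_mono mult_left_le_one_le)
  from grid_contraction[OF this assms]
  show "shift1 alpha_weight f \<in> Lsq grid" "Lsq_norm grid (shift1 alpha_weight f) \<le> Lsq_norm grid f" .
qed

lemma shift2_contraction:
  assumes "f \<in> Lsq grid"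
  shows "shift2 beta_weight f \<in> Lsq grid" "Lsq_norm grid (shift2 beta_weight f) \<le> Lsq_norm grid f"
proof -
  have "(\<Sum>k\<in>degree_le (Suc n). (cmod (shift2 beta_weight f k))\<^sup>2) \<le> (\<Sum>k\<in>degree_le n. (cmod (f k))\<^sup>2)" for n
    using beta_weight_bounds
    by (subst sum_degree_le_shift2)
      (auto simp: shift2_def norm_mult power_mult_distrib less_imp_le power_le_one intro!: sum_mono mult_left_le_one_le)
  from grid_contraction[OF this assms]
  show "shift2 beta_weight f \<in> Lsq grid" "Lsq_norm grid (shift2 beta_weight f) \<le> Lsq_norm grid f" .
qed

lemma unitarily_equivalent_shifts_hardy:
  "unitarily_equivalent_pairs grid (Lsq grid) (shift1 alpha_weight, shift2 beta_weight)
    normalized_surface_S3 hardy_S3 (mult_op fst, mult_op snd)"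
  unfolding unitarily_equivalent_pairs_def fst_conv snd_conv
proof (intro conjI exI[of _ hardy.synthesis] ballI)
  have c: "continuous_on UNIV (fst :: complex \<times> complex \<Rightarrow> _)" "continuous_on UNIV (snd :: complex \<times> complex \<Rightarrow> _)"
    by (intro continuous_intros)+
  note w = c(1) cmod_coordinate_le(1) and w' = c(2) cmod_coordinate_le(2)
  show "shift1 alpha_weight \<in> Lsq grid \<rightarrow> Lsq grid" "shift2 beta_weight \<in> Lsq grid \<rightarrow> Lsq grid"
    using shift1_contraction(1) shift2_contraction(1) by auto
  show "mult_op fst \<in> hardy_S3 \<rightarrow> hardy_S3"
    by (rule mult_op_hardy[OF w partial_shift1])
  show "mult_op snd \<in> hardy_S3 \<rightarrow> hardy_S3"
    by (rule mult_op_hardy[OF w' partial_shift2])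
  show "unitary_between grid (Lsq grid) normalized_surface_S3 hardy_S3 hardy.synthesis"
    unfolding hardy_S3_eq_closed_span by (rule hardy.unitary_synthesis)
  fix f assume f: "f \<in> Lsq grid"
  show "AE y in normalized_surface_S3. hardy.synthesis (shift1 alpha_weight f) y = mult_op fst (hardy.synthesis f) y"
    by (rule hardy.expands_unique[OF hardy.expands_synthesis[OF shift1_contraction(1)[OF f]]
          expands_mult[of fst, OF w partial_shift1 hardy.expands_synthesis[OF f]]])
  show "AE y in normalized_surface_S3. hardy.synthesis (shift2 beta_weight f) y = mult_op snd (hardy.synthesis f) y"
    by (rule hardy.expands_unique[OF hardy.expands_synthesis[OF shift2_contraction(1)[OF f]]
          expands_mult[of snd, OF w' partial_shift2 hardy.expands_synthesis[OF f]]])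
qed

section \<open>Uniqueness of the Berger measure\<close>

text \<open>
  For \<open>x\<close> in the unit interval all partial sums of the series of \<open>exp (\<i> t x)\<close> are bounded by
  \<open>exp |t|\<close>, so it may be integrated term by term, and the moments determine the characteristic
  function.
\<close>

lemma char_eq_lim_moments:
  assumes M: "real_distribution M" and I: "AE x in M. x \<in> {0..1}"
  shows "(\<lambda>N. \<Sum>k<N. (\<i> * t) ^ k / fact k * complex_of_real (\<integral>x. x ^ k \<partial>M)) \<longlonglongrightarrow> char M t"
proof -
  interpret real_distribution M by fact
  define s where "s = (\<lambda>N x. \<Sum>k<N. (\<i> * t) ^ k / fact k * complex_of_real (x ^ k))"
  have [measurable]: "(\<lambda>x::real. x ^ k) \<in> borel_measurable M" for k
    by measurable
  have int: "integrable M (\<lambda>x::real. x ^ k)" for k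
  proof (rule integrable_const_bound[where B = 1])
    show "AE x in M. norm (x ^ k) \<le> 1"
      using I by eventually_elim (auto simp: power_le_one)
  qed simp
  have "(\<integral>x. s N x \<partial>M) = (\<Sum>k<N. (\<i> * t) ^ k / fact k * complex_of_real (\<integral>x. x ^ k \<partial>M))" for N
  proof -
    have "(\<integral>x. s N x \<partial>M) = (\<Sum>k<N. \<integral>x. (\<i> * t) ^ k / fact k * complex_of_real (x ^ k) \<partial>M)"
      unfolding s_def
      by (intro Bochner_Integration.integral_sum integrable_mult_right integrable_of_real int)
    then show ?thesis
      by (simp only: integral_mult_right_zero integral_complex_of_real)
  qed
  moreover have "(\<lambda>N. \<integral>x. s N x \<partial>M) \<longlonglongrightarrow> (\<integral>x. iexp (t * x) \<partial>M)"
  proof (rule integral_dominated_convergence[where w = "\<lambda>_. exp \<bar>t\<bar>"])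
    show "s N \<in> borel_measurable M" for N
      unfolding s_def by measurable
    show "AE x in M. (\<lambda>N. s N x) \<longlonglongrightarrow> iexp (t * x)"
    proof (rule AE_I2)
      fix x
      have "(\<lambda>k. (\<i> * (t * x)) ^ k /\<^sub>R fact k) sums exp (\<i> * (t * x))"
        by (rule exp_converges)
      then show "(\<lambda>N. s N x) \<longlonglongrightarrow> iexp (t * x)"
        unfolding sums_def s_def
        by (simp add: scaleR_conv_of_real power_mult_distrib divide_inverse mult_ac)
    qed
    show "AE x in M. norm (s N x) \<le> exp \<bar>t\<bar>" for N
      using I
    proof eventually_elim
      case (elim x)
      have "norm (s N x) \<le> (\<Sum>k<N. norm ((\<i> * t) ^ k / fact k * complex_of_real (x ^ k)))"
        unfolding s_def by (rule norm_sum)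
      also have "\<dots> \<le> (\<Sum>k<N. \<bar>t\<bar> ^ k /\<^sub>R fact k)"
      proof (rule sum_mono)
        fix k
        have "norm ((\<i> * t) ^ k / fact k * complex_of_real (x ^ k)) = x ^ k * (\<bar>t\<bar> ^ k /\<^sub>R fact k)"
          using elim by (simp add: norm_mult norm_inverse norm_power divide_inverse norm_fact)
        also have "\<dots> \<le> \<bar>t\<bar> ^ k /\<^sub>R fact k"
          using elim by (intro mult_left_le_one_le) (auto simp: power_le_one)
        finally show "norm ((\<i> * t) ^ k / fact k * complex_of_real (x ^ k)) \<le> \<bar>t\<bar> ^ k /\<^sub>R fact k" .
      qed
      also have "\<dots> \<le> (\<Sum>k. \<bar>t\<bar> ^ k /\<^sub>R fact k)"
        by (intro sum_le_suminf summable_exp_generic) auto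
      also have "\<dots> = exp \<bar>t\<bar>" by (simp add: exp_def)
      finally show ?case .
    qed
  qed (auto intro: borel_measurable_continuous_onI)
  ultimately show ?thesis
    by (simp add: char_def)
qed

lemma moments_unit_interval_unique:
  assumes M: "real_distribution M" "AE x in M. x \<in> {0..1}"
    and N: "real_distribution N" "AE x in N. x \<in> {0..1}"
    and eq: "\<And>k. (\<integral>x. x ^ k \<partial>M) = (\<integral>x. x ^ k \<partial>N)"
  shows "M = N"
proof (rule Levy_uniqueness[OF M(1) N(1)])
  show "char M = char N"
    using LIMSEQ_unique[OF char_eq_lim_moments[OF M] char_eq_lim_moments[OF N, folded eq]]
    by (rule ext)
qed

lemma shift_moment_weights:
  "shift_moment alpha_weight beta_weight k1 k2 = fact k1 * fact k2 / fact (k1 + k2 + 1)"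
proof -
  have 1: "(\<Prod>i<k. (alpha_weight i 0)\<^sup>2) = 1 / (real k + 1)" for k
    by (induction k) (auto simp: alpha_weight_def field_simps)
  have 2: "(\<Prod>j<k2. (beta_weight k1 j)\<^sup>2) = fact k2 * fact (k1 + 1) / fact (k1 + k2 + 1)"
  proof (induction k2)
    case (Suc k)
    have "(beta_weight k1 k)\<^sup>2 = (real k + 1) / (real k1 + real k + 2)"
      by (simp add: beta_weight_def)
    moreover have "fact (k1 + Suc k + 1) = (real k1 + real k + 2) * fact (k1 + k + 1)"
      by (simp add: algebra_simps)
    moreover have "fact (Suc k) = (real k + 1) * fact k" by simp
    ultimately show ?case using Suc by (simp add: mult_ac add_ac)
  qed simp
  have "fact (k1 + 1) = (real k1 + 1) * fact k1" by simp
  moreover have "1 / c * (x * (c * y) / z) = y * x / z" if "c \<noteq> 0" for c x y z :: real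
    using that by simp
  moreover have "real k1 + 1 \<noteq> 0" by linarith
  ultimately show ?thesis
    unfolding shift_moment_def 1 2 by metis
qed

lemma Lsq_norm_indicator: "Lsq_norm grid (indicator {p}) = 1"
proof -
  have "(\<lambda>x. (cmod (indicator {p} x))\<^sup>2) = (indicator {p} :: nat \<times> nat \<Rightarrow> real)"
    by (auto simp: indicator_def)
  then show ?thesis by (simp add: Lsq_norm_def)
qed

text \<open>
  The weights \<open>sqrt ((n + 1) / (n + 2))\<close> along an axis increase to 1. The contraction property is
  what makes the supremum in the operator norm one of a bounded set.
\<close>

lemma one_le_Lsq_opnorm:
  assumes contr: "\<And>f. f \<in> Lsq grid \<Longrightarrow> Lsq_norm grid (T f) \<le> Lsq_norm grid f"
    and T: "\<And>n. \<exists>p q. T (indicator {p}) = (\<lambda>x. complex_of_real (sqrt ((real n + 1) / (real n + 2))) * indicator {q} x)"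
  shows "1 \<le> Lsq_opnorm grid T"
proof -
  let ?S = "{Lsq_norm grid (T f) | f. f \<in> Lsq grid \<and> Lsq_norm grid f \<le> 1}"
  have bdd: "bdd_above ?S"
    using contr by (intro bdd_aboveI[of _ 1]) (auto intro: order_trans)
  have "sqrt ((real n + 1) / (real n + 2)) \<le> Lsq_opnorm grid T" for n
  proof -
    obtain p q where pq: "T (indicator {p}) = (\<lambda>x. complex_of_real (sqrt ((real n + 1) / (real n + 2))) * indicator {q} x)"
      using T by blast
    have "(\<lambda>x. (cmod (indicator {p} x))\<^sup>2) = (indicator {p} :: nat \<times> nat \<Rightarrow> real)"
      by (auto simp: indicator_def)
    then have "indicator {p} \<in> Lsq grid" by (simp add: Lsq_def)
    moreover have "Lsq_norm grid (T (indicator {p})) = sqrt ((real n + 1) / (real n + 2))"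
      unfolding pq Lsq_norm_cmult Lsq_norm_indicator by simp
    ultimately show ?thesis
      unfolding Lsq_opnorm_def using Lsq_norm_indicator by (intro cSup_upper bdd CollectI exI[of _ "indicator {p}"]) auto
  qed
  moreover have "(\<lambda>n. sqrt ((real n + 1) / (real n + 2))) \<longlonglongrightarrow> 1"
    by real_asymp
  ultimately show ?thesis
    by (intro LIMSEQ_le_const2) auto
qed

lemma one_le_opnorm_shifts:
  "1 \<le> Lsq_opnorm grid (shift1 alpha_weight)" "1 \<le> Lsq_opnorm grid (shift2 beta_weight)"
proof -
  show "1 \<le> Lsq_opnorm grid (shift1 alpha_weight)"
  proof (rule one_le_Lsq_opnorm[OF shift1_contraction(2)])
    fix n
    show "\<exists>p q. shift1 alpha_weight (indicator {p})
        = (\<lambda>x. complex_of_real (sqrt ((real n + 1) / (real n + 2))) * indicator {q} x)"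
      using shift1_basis[of alpha_weight n 0] unfolding alpha_weight_def by auto
  qed
  show "1 \<le> Lsq_opnorm grid (shift2 beta_weight)"
  proof (rule one_le_Lsq_opnorm[OF shift2_contraction(2)])
    fix n
    show "\<exists>p q. shift2 beta_weight (indicator {p})
        = (\<lambda>x. complex_of_real (sqrt ((real n + 1) / (real n + 2))) * indicator {q} x)"
      using shift2_basis[of beta_weight 0 n] unfolding beta_weight_def by auto
  qed
qed

text \<open>
  The moments of degree at most 2 show that \<open>(s + t - 1)\<^sup>2\<close> has integral 0, so the measure lives on
  the line \<open>s + t = 1\<close> and is the image of its first marginal, whose moments are those of the
  uniform distribution.
\<close>

lemma segment_measure_unique:
  assumes \<mu>: "prob_space \<mu>" and sets: "sets \<mu> = sets borel"
    and box: "AE x in \<mu>. x \<in> {0..A} \<times> {0..B}"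
    and mom: "\<And>k1 k2. (\<integral>x. fst x ^ k1 * snd x ^ k2 \<partial>\<mu>) = fact k1 * fact k2 / fact (k1 + k2 + 1)"
  shows "\<mu> = normalized_arclength_L"
proof -
  interpret prob_space \<mu> by fact
  note [measurable_cong] = sets
  let ?\<phi> = "\<lambda>r :: real. (r, 1 - r)"
  have \<phi> [measurable]: "?\<phi> \<in> borel_measurable borel"
    by (intro borel_measurable_continuous_onI continuous_intros)
  have meas: "F \<in> borel_measurable \<mu>" if "continuous_on UNIV F" for F :: "real \<times> real \<Rightarrow> 'c::topological_space"
    using borel_measurable_continuous_onI[OF that] measurable_cong_sets[OF sets refl] by blast
  have [measurable]: "fst \<in> borel_measurable \<mu>" "snd \<in> borel_measurable \<mu>"
    by (intro meas continuous_intros)+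
  have int: "integrable \<mu> (\<lambda>x. fst x ^ k * snd x ^ l)" for k l
  proof (rule integrable_const_bound[where B = "A ^ k * B ^ l"])
    show "AE x in \<mu>. norm (fst x ^ k * snd x ^ l) \<le> A ^ k * B ^ l"
      using box
    proof eventually_elim
      case (elim x)
      then have "0 \<le> fst x" "fst x \<le> A" "0 \<le> snd x" "snd x \<le> B" by (auto simp: mem_Times_iff)
      then show ?case by (auto simp: abs_mult intro!: mult_mono power_mono)
    qed
  qed measurable
  have expand: "(fst x + snd x - 1)\<^sup>2 = fst x ^ 2 * snd x ^ 0 + fst x ^ 0 * snd x ^ 2 + fst x ^ 0 * snd x ^ 0
      + 2 * (fst x ^ 1 * snd x ^ 1) - 2 * (fst x ^ 1 * snd x ^ 0) - 2 * (fst x ^ 0 * snd x ^ 1)" for x :: "real \<times> real"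
    by (simp add: power2_eq_square algebra_simps)
  have int2: "integrable \<mu> (\<lambda>x. (fst x + snd x - 1)\<^sup>2)"
    unfolding expand by (intro Bochner_Integration.integrable_add Bochner_Integration.integrable_diff integrable_mult_right int)
  have "(\<integral>x. (fst x + snd x - 1)\<^sup>2 \<partial>\<mu>) = (\<integral>x. fst x ^ 2 * snd x ^ 0 \<partial>\<mu>) + (\<integral>x. fst x ^ 0 * snd x ^ 2 \<partial>\<mu>)
      + (\<integral>x. fst x ^ 0 * snd x ^ 0 \<partial>\<mu>) + 2 * (\<integral>x. fst x ^ 1 * snd x ^ 1 \<partial>\<mu>)
      - 2 * (\<integral>x. fst x ^ 1 * snd x ^ 0 \<partial>\<mu>) - 2 * (\<integral>x. fst x ^ 0 * snd x ^ 1 \<partial>\<mu>)"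
    unfolding expand
    by (simp only: Bochner_Integration.integral_add Bochner_Integration.integral_diff
        Bochner_Integration.integrable_add Bochner_Integration.integrable_diff integrable_mult_right int
        integral_mult_right_zero)
  also have "\<dots> = 0"
    unfolding mom by (simp add: fact_numeral)
  finally have "AE x in \<mu>. (fst x + snd x - 1)\<^sup>2 = 0"
    using int2 by (subst (asm) integral_nonneg_eq_0_iff_AE) auto
  then have line: "AE x in \<mu>. x = ?\<phi> (fst x) \<and> fst x \<in> {0..1}"
    using box
  proof eventually_elim
    case (elim x)
    then show ?case by (cases x) auto
  qed
  define \<nu> where "\<nu> = distr \<mu> borel fst"
  have \<nu>: "real_distribution \<nu>"
    unfolding \<nu>_def by (rule real_distribution_distr) simp
  have unif: "prob_space (uniform_measure lborel {0..1::real})"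
    by (rule prob_space_uniform_measure) auto
  have "\<nu> = uniform_measure lborel {0..1}"
  proof (rule moments_unit_interval_unique[OF \<nu>])
    show "AE x in \<nu>. x \<in> {0..1}"
      unfolding \<nu>_def using line by (subst AE_distr_iff) auto
    show "real_distribution (uniform_measure lborel {0..1})"
      using unif by (simp add: real_distribution_def real_distribution_axioms_def)
    show "AE x in uniform_measure lborel {0..1::real}. x \<in> {0..1}"
      by (intro AE_uniform_measureI) auto
    fix k
    have "(\<integral>x. x ^ k \<partial>\<nu>) = (\<integral>x. fst x ^ k * snd x ^ 0 \<partial>\<mu>)"
      unfolding \<nu>_def by (subst integral_distr) auto
    also have "\<dots> = 1 / (real k + 1)"
      unfolding mom by simp
    also have "\<dots> = (\<integral>x. x ^ k \<partial>uniform_measure lborel {0..1})"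
      using is_berger_measure1_bergman unfolding is_berger_measure1_def prod_bergman_weight by auto
    finally show "(\<integral>x. x ^ k \<partial>\<nu>) = (\<integral>x. x ^ k \<partial>uniform_measure lborel {0..1})" .
  qed
  then have "normalized_arclength_L = distr (distr \<mu> borel fst) borel ?\<phi>"
    by (simp add: normalized_arclength_L_eq \<nu>_def)
  also have "\<dots> = distr \<mu> borel (\<lambda>x. ?\<phi> (fst x))"
    by (simp add: distr_distr comp_def)
  also have "\<dots> = distr \<mu> borel (\<lambda>x. x)"
    using line by (intro distr_cong_AE) (auto elim!: eventually_mono)
  also have "\<dots> = \<mu>"
    by (rule distr_id2[OF sets[symmetric]])
  finally show ?thesis ..
qed

lemma is_berger_measure2_normalized_arclength_L:
  "is_berger_measure2 alpha_weight beta_weight normalized_arclength_L"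
  unfolding is_berger_measure2_def
proof (intro conjI allI)
  let ?U = "uniform_measure lborel {0..1::real}"
  let ?\<phi> = "\<lambda>r :: real. (r, 1 - r)"
  have [measurable]: "?\<phi> \<in> borel_measurable borel"
    by (intro borel_measurable_continuous_onI continuous_intros)
  have m: "?\<phi> \<in> borel_measurable ?U" by measurable
  interpret U: prob_space ?U
    by (rule prob_space_uniform_measure) auto
  show "prob_space normalized_arclength_L"
    unfolding normalized_arclength_L_eq by (rule U.prob_space_distr[OF m])
  show "sets normalized_arclength_L = sets borel"
    by (simp add: normalized_arclength_L_eq)
  have I: "{0..1} \<subseteq> {0..(Lsq_opnorm grid (shift1 alpha_weight))\<^sup>2}" "{0..1} \<subseteq> {0..(Lsq_opnorm grid (shift2 beta_weight))\<^sup>2}"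
    using one_le_opnorm_shifts by (auto intro: order_trans simp: one_le_power)
  have "AE r in ?U. r \<in> {0..1}"
    by (intro AE_uniform_measureI) auto
  then have "AE r in ?U. ?\<phi> r \<in> {0..(Lsq_opnorm grid (shift1 alpha_weight))\<^sup>2} \<times> {0..(Lsq_opnorm grid (shift2 beta_weight))\<^sup>2}"
  proof eventually_elim
    case (elim r)
    then have "r \<in> {0..1}" "1 - r \<in> {0..1}" by auto
    then show ?case using I by blast
  qed
  then show "AE x in normalized_arclength_L. x \<in> {0..(Lsq_opnorm grid (shift1 alpha_weight))\<^sup>2} \<times> {0..(Lsq_opnorm grid (shift2 beta_weight))\<^sup>2}"
    unfolding normalized_arclength_L_eq
    by (subst AE_distr_iff[OF m]) (simp_all add: borel_closed closed_Times del: mem_Sigma_iff)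
  fix k1 k2
  have "(\<integral>x. fst x ^ k1 * snd x ^ k2 \<partial>normalized_arclength_L) = (\<integral>r. r ^ k1 * (1 - r) ^ k2 \<partial>?U)"
    unfolding normalized_arclength_L_eq
    by (subst integral_distr[OF m]) (auto intro!: borel_measurable_continuous_onI continuous_intros)
  also have "\<dots> = fact k1 * fact k2 / fact (k1 + k2 + 1)"
    using sie_moment_bergman[OF is_berger_measure1_bergman] unfolding sie_moment_def .
  finally show "shift_moment alpha_weight beta_weight k1 k2 = (\<integral>x. fst x ^ k1 * snd x ^ k2 \<partial>normalized_arclength_L)"
    by (simp add: shift_moment_weights)
qed

theorem theorem5p2:
  fixes \<sigma> :: "real measure"
  assumes "is_berger_measure1 bergman_weight \<sigma>"
  shows "(\<forall>\<mu>. is_berger_measure2 (sie_alpha \<sigma>) (sie_beta \<sigma>) \<mu> \<longleftrightarrow> \<mu> = normalized_arclength_L) \<and>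
    unitarily_equivalent_pairs
      grid (Lsq grid) (shift1 (sie_alpha \<sigma>), shift2 (sie_beta \<sigma>))
      normalized_surface_S3 hardy_S3 (mult_op fst, mult_op snd)"
proof -
  have "sie_alpha \<sigma> = alpha_weight"
    by (simp add: fun_eq_iff sie_alpha_bergman[OF assms] alpha_weight_def)
  moreover have "sie_beta \<sigma> = beta_weight"
    by (simp add: fun_eq_iff sie_beta_bergman[OF assms] beta_weight_def)
  moreover have "\<mu> = normalized_arclength_L" if "is_berger_measure2 alpha_weight beta_weight \<mu>" for \<mu>
    using that unfolding is_berger_measure2_def shift_moment_weights
    by (intro segment_measure_unique) auto
  ultimately show ?thesis
    using is_berger_measure2_normalized_arclength_L unitarily_equivalent_shifts_hardy by auto
qed

end
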